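(* Let $h$ be a Borel measurable, real-valued integrable function, and let $X\sim\mathcal N_p(\mu,\Sigma)$, where $\Sigma$ is a nonnegative definite $p\times p$ matrix with rank $k\le p$. Let $A$ be a $p\times p$ nonnegative definite matrix with rank $k$ such that $\Sigma A$ is idempotent, $A\Sigma A=A$, $\Sigma A\Sigma=\Sigma$ and $\Sigma A\mu=\mu$, and let $W=A^{1/2}W^*A^{1/2}$, where $W^*$ is a nonnegative definite $p\times p$ matrix. Let $D_1=\mathrm{trace}(W\Sigma)$ and $D_2=\mu'W\mu$. Then $$E[h(X'AX)\,X'WX]=E\bigl[h(\chi^2_{k+2}(\mu'A\mu))\bigr]D_1+E\bigl[h(\chi^2_{k+4}(\mu'A\mu))\bigr]D_2 .$$
   Context: $\chi^2_\nu(\Delta)$ denotes a noncentral chi-square variable with $\nu$ degrees of freedom and noncentrality $\Delta$, i.e. the law of $\|N\|^2$ with $N\sim\mathcal N_\nu(\theta,I_\nu)$ and $\|\theta\|^2=\Delta$. Nonnegative definite matrices are symmetric; $A^{1/2}$ is the nonnegative definite square root. A normal law with singular covariance is allowed. "Integrable" means (with respect to the relevant Gaussian measure) that the expectations appearing in the identity are well defined and finite. *)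

theory Defs
  imports "HOL-Probability.Probability"
begin

definition nonneg_definite :: "real^'n^'n \<Rightarrow> bool" where
  "nonneg_definite A \<longleftrightarrow> transpose A = A \<and> (\<forall>x. 0 \<le> x \<bullet> (A *v x))"

definition nnd_sqrt :: "real^'n^'n \<Rightarrow> real^'n^'n" where
  "nnd_sqrt A = (THE B. nonneg_definite B \<and> B ** B = A)"

text \<open>The normal law with mean \<open>\<theta>\<close> and identity covariance on \<open>\<real>\<^sup>I\<close>. The index set is explicit,
  so that the dimension may be a number computed from other data.\<close>

definition normal_id :: "'i set \<Rightarrow> ('i \<Rightarrow> real) \<Rightarrow> ('i \<Rightarrow> real) measure" where
  "normal_id I \<theta> = (\<Pi>\<^sub>M i\<in>I. density lborel (normal_density (\<theta> i) 1))"

text \<open>The normal law with mean \<open>\<mu>\<close> and (possibly singular) covariance \<open>S\<close>: the law of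
  \<open>\<mu> + S\<^sup>1\<^sup>/\<^sup>2 Z\<close> with \<open>Z\<close> standard normal.\<close>

definition mvnormal :: "real^'n \<Rightarrow> real^'n^'n \<Rightarrow> (real^'n) measure" where
  "mvnormal \<mu> S =
     distr (normal_id UNIV (\<lambda>_. 0)) borel (\<lambda>z. \<mu> + nnd_sqrt S *v (\<chi> i. z i))"

text \<open>\<open>Q\<close> is the law of \<open>\<parallel>N\<parallel>\<^sup>2\<close>, where \<open>N\<close> is normal in dimension \<open>\<nu>\<close> with identity covariance and
  some mean vector \<open>\<theta>\<close> satisfying \<open>\<parallel>\<theta>\<parallel>\<^sup>2 = \<Delta>\<close>. By rotation invariance \<open>Q\<close> does not depend
  on the choice of \<open>\<theta>\<close>; the relational form avoids fixing one.\<close>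

definition noncentral_chi_square :: "nat \<Rightarrow> real \<Rightarrow> real measure \<Rightarrow> bool" where
  "noncentral_chi_square \<nu> \<Delta> Q \<longleftrightarrow>
     (\<exists>\<theta>. (\<Sum>i<\<nu>. (\<theta> i)\<^sup>2) = \<Delta> \<and>
          Q = distr (normal_id {..<\<nu>} \<theta>) borel (\<lambda>z. \<Sum>i<\<nu>. (z i)\<^sup>2))"

lemma sets_normal_id:
  "sets (normal_id I \<theta>) = sets (\<Pi>\<^sub>M i\<in>I. (borel :: real measure))"
  unfolding normal_id_def by (rule sets_PiM_cong) auto

lemma prob_space_normal_id: "prob_space (normal_id I \<theta>)"
  unfolding normal_id_def by (rule prob_space_PiM) (simp add: prob_space_normal_density)

lemma measurable_mvnormal_map:
  fixes \<mu> :: "real^'n" and \<theta> :: "'n \<Rightarrow> real"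
  shows "(\<lambda>z. \<mu> + B *v (\<chi> i. z i)) \<in> borel_measurable (normal_id UNIV \<theta>)"
proof -
  have "(\<lambda>z. z i) \<in> borel_measurable (\<Pi>\<^sub>M i\<in>UNIV. (borel :: real measure))" for i :: 'n
    by (rule measurable_component_singleton) simp
  then have coord: "(\<lambda>z. z i) \<in> borel_measurable (normal_id UNIV \<theta>)" for i :: 'n
    using measurable_cong_sets[OF sets_normal_id[of UNIV \<theta>] refl] by blast
  have "(\<lambda>z. (\<chi> i. z i) :: real^'n) \<in> borel_measurable (normal_id UNIV \<theta>)"
    by (subst borel_measurable_euclidean_space)
      (auto simp: Basis_vec_def inner_axis intro: coord)
  moreover have "(\<lambda>v. \<mu> + B *v v) \<in> borel_measurable borel"
    by (intro borel_measurable_continuous_onI continuous_on_add continuous_on_const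
        matrix_vector_mult_linear_continuous_on)
  ultimately show ?thesis
    by (rule measurable_compose)
qed

lemma prob_space_mvnormal: "prob_space (mvnormal \<mu> S)"
  unfolding mvnormal_def
  by (intro prob_space.prob_space_distr prob_space_normal_id measurable_mvnormal_map)

lemma measurable_sum_squares:
  "(\<lambda>z. \<Sum>i<\<nu>. (z i)\<^sup>2) \<in> borel_measurable (normal_id {..<\<nu>} \<theta>)"
proof -
  have "(\<lambda>z. \<Sum>i<\<nu>. (z i)\<^sup>2) \<in> borel_measurable (\<Pi>\<^sub>M i\<in>{..<\<nu>}. (borel :: real measure))"
    by measurable
  then show ?thesis
    using measurable_cong_sets[OF sets_normal_id refl] by blast
qed

lemma prob_space_noncentral_chi_square:
  "noncentral_chi_square \<nu> \<Delta> Q \<Longrightarrow> prob_space Q"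
  unfolding noncentral_chi_square_def
  by (auto intro!: prob_space.prob_space_distr prob_space_normal_id measurable_sum_squares)

lemma ex_noncentral_chi_square:
  assumes "0 < \<nu>" "0 \<le> \<Delta>"
  shows "\<exists>Q. noncentral_chi_square \<nu> \<Delta> Q"
proof -
  define \<theta> where "\<theta> = (\<lambda>i::nat. if i = 0 then sqrt \<Delta> else 0)"
  have "(\<Sum>i<\<nu>. (\<theta> i)\<^sup>2) = (\<Sum>i<\<nu>. if i = 0 then \<Delta> else 0)"
    using assms by (intro sum.cong) (auto simp: \<theta>_def)
  also have "\<dots> = \<Delta>"
    using assms by (simp add: sum.delta)
  finally show ?thesis
    unfolding noncentral_chi_square_def by blast
qed

end

(* Writing B for the square root of Sigma, X = B N with N normal of identity covariance and mean
   B A mu. Then X'AX = N'QN and X'WX = N'VN, where Q = BAB is a projection of rank k and V = BWB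
   satisfies QV = VQ = V. In an orthonormal basis diagonalizing Q and V the statement reduces to
   E[h(|N|^2) N_j^2] = E[h(chi^2_{k+2})] + m_j^2 E[h(chi^2_{k+4})] for N normal in dimension k with
   mean m. With a = 1 + 2s, the measures on both sides have the same Laplace transform
   a^(-k/2) exp(-s |m|^2 / a) (1/a + m_j^2/a^2). *)
theory Submission
  imports Defs
begin

section \<open>Spectral theorem and square roots\<close>

text \<open>The function \<open>h\<close> enters only after two measures on the real line have been
  identified, so it may be any signed Borel function integrable under the two chi-square laws, and
  no density of those laws is computed. Both measures live on the nonnegative half-line, where the
  Laplace transform at s = 0, 1, 2, ... already identifies a finite measure. The number a is the
  inverse variance that results when a unit normal density is multiplied by exp (- s x^2); the
  tilted law has mean m/a and second moment 1/a + m^2/a^2. The factors 1/a and 1/a^2 then read as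
  two and four extra degrees of freedom, with the noncentrality in the exponent unchanged. The
  algebraic hypotheses act through two facts. B and \<open>\<Sigma>\<close> have the same kernel, so
  \<open>\<Sigma> ** A ** \<Sigma> = \<Sigma>\<close> can be cancelled to
  \<open>B ** A ** \<Sigma> = B\<close>, which yields QV = VQ = V. And \<Sigma> A \<mu> = \<mu> puts
  the mean into the range of B, which is what allows a singular \<open>\<Sigma>\<close>.\<close>

lemma symmetric_inner_mult:
  fixes S :: "real^'n^'n"
  assumes "transpose S = S"
  shows "(S *v x) \<bullet> y = x \<bullet> (S *v y)"
  by (metis assms dot_lmul_matrix transpose_matrix_vector)

text \<open>A first-order condition at t = 0: near zero the linear term dominates, whatever the sign
  of \<open>c\<close>. It serves both the Rayleigh maximum and the kernel of a nonnegative
  form.\<close>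

lemma zero_if_quadratic_nonneg:
  fixes b c :: real
  assumes "\<And>t. 0 \<le> 2 * t * b + t\<^sup>2 * c"
  shows "b = 0"
proof (rule ccontr)
  assume "b \<noteq> 0"
  \<comment> \<open>A positive bound for \<open>c\<close>: replacing \<open>c\<close> by
    \<open>d\<close> only raises the quadratic, and t = - b / d minimizes this majorant.\<close>
  define d where "d = \<bar>c\<bar> + 1"
  have d: "d > 0" "c \<le> d" by (auto simp: d_def)
  have "0 \<le> 2 * (- b / d) * b + (- b / d)\<^sup>2 * c" by (rule assms)
  also have "\<dots> \<le> 2 * (- b / d) * b + (- b / d)\<^sup>2 * d"
    using d by (intro add_left_mono mult_left_mono) auto
  also have "\<dots> = - b\<^sup>2 / d"
    using d by (simp add: field_simps power2_eq_square)
  finally show False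
    using d \<open>b \<noteq> 0\<close> by (simp add: field_simps)
qed

text \<open>The unit sphere of \<open>U\<close> is compact, so the Rayleigh quotient has a maximizer
  there; it is an eigenvector, since invariance of \<open>U\<close> keeps the gradient inside
  \<open>U\<close>.\<close>

lemma ex_eigenvector_in_subspace:
  fixes S :: "real^'n^'n"
  assumes sym: "transpose S = S" and U: "subspace U"
    and inv: "\<And>x. x \<in> U \<Longrightarrow> S *v x \<in> U" and "u \<in> U" "u \<noteq> 0"
  shows "\<exists>v\<in>U. norm v = 1 \<and> (\<exists>l. S *v v = l *\<^sub>R v)"
proof -
  define K where "K = U \<inter> sphere 0 1"
  have "compact K"
    unfolding K_def using U by (intro closed_Int_compact closed_subspace) auto
  moreover have "(1 / norm u) *\<^sub>R u \<in> K"
    using assms by (auto simp: K_def subspace_scale)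
  moreover have "continuous_on K (\<lambda>x. x \<bullet> (S *v x))"
    by (intro continuous_intros matrix_vector_mult_linear_continuous_on)
  ultimately obtain v where v: "v \<in> K" and max: "\<And>x. x \<in> K \<Longrightarrow> x \<bullet> (S *v x) \<le> v \<bullet> (S *v v)"
    by (metis continuous_attains_sup empty_iff)
  define l where "l = v \<bullet> (S *v v)"
  have vU: "v \<in> U" and nv: "norm v = 1" "v \<bullet> v = 1"
    using v by (auto simp: K_def norm_eq_1)
  have bound: "x \<bullet> (S *v x) \<le> l * (x \<bullet> x)" if "x \<in> U" for x
  proof (cases "x = 0")
    case False
    then have "(1 / norm x) *\<^sub>R x \<in> K"
      using that U by (auto simp: K_def subspace_scale)
    from max[OF this] have "(x \<bullet> (S *v x)) / (norm x)\<^sup>2 \<le> l"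
      by (simp add: l_def matrix_vector_mult_scaleR power2_eq_square)
    then show ?thesis
      using False by (simp add: field_simps power2_norm_eq_inner)
  qed simp
  \<comment> \<open>Half the gradient at \<open>v\<close> of l (x . x) - x . S x, a function that is
    nonnegative on \<open>U\<close> and vanishes at \<open>v\<close>. Its first-order term in
    direction \<open>w\<close> is 2 t (w . w), so \<open>w\<close> must be zero.\<close>
  define w where "w = l *\<^sub>R v - S *v v"
  have wU: "w \<in> U"
    unfolding w_def using U vU inv by (intro subspace_diff subspace_scale) auto
  have "w \<bullet> w = 0"
  proof (rule zero_if_quadratic_nonneg)
    fix t :: real
    have "v + t *\<^sub>R w \<in> U"
      using U vU wU by (intro subspace_add subspace_scale) auto
    from bound[OF this]
    have "0 \<le> l * ((v + t *\<^sub>R w) \<bullet> (v + t *\<^sub>R w)) - (v + t *\<^sub>R w) \<bullet> (S *v (v + t *\<^sub>R w))"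
      by simp
    also have "\<dots> = 2 * t * (l * (v \<bullet> w) - (S *v v) \<bullet> w) + t\<^sup>2 * (l * (w \<bullet> w) - w \<bullet> (S *v w))"
      using nv symmetric_inner_mult[OF sym, of v w]
      by (simp add: matrix_vector_right_distrib matrix_vector_mult_scaleR inner_simps
          inner_commute l_def algebra_simps power2_eq_square)
    also have "l * (v \<bullet> w) - (S *v v) \<bullet> w = w \<bullet> w"
      by (simp add: w_def inner_simps inner_commute algebra_simps l_def nv)
    finally show "0 \<le> 2 * t * (w \<bullet> w) + t\<^sup>2 * (l * (w \<bullet> w) - w \<bullet> (S *v w))" .
  qed
  then have "S *v v = l *\<^sub>R v"
    by (simp add: w_def)
  with vU nv show ?thesis by blast
qed

text \<open>Take an orthonormal set of eigenvectors of greatest cardinality. If it were too small,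
  its orthogonal complement, which \<open>S\<close> preserves by symmetry, would contain another
  unit eigenvector.\<close>

lemma symmetric_orthonormal_eigenbasis:
  fixes S :: "real^'n^'n"
  assumes sym: "transpose S = S"
  obtains r :: "'n \<Rightarrow> real^'n" and l :: "'n \<Rightarrow> real"
  where "\<And>i j. r i \<bullet> r j = (if i = j then 1 else 0)" "\<And>i. S *v r i = l i *\<^sub>R r i"
proof -
  define P where "P E \<longleftrightarrow> pairwise orthogonal E \<and> (\<forall>v\<in>E. norm v = 1 \<and> (\<exists>l. S *v v = l *\<^sub>R v))"
    for E :: "(real^'n) set"
  have indep: "independent E" if "P E" for E
    using that by (intro pairwise_orthogonal_independent) (auto simp: P_def)
  then have bd: "finite E \<and> card E \<le> DIM(real^'n)" if "P E" for E
    using that independent_bound by blast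
  have "P {}" by (simp add: P_def)
  moreover have "\<forall>F. P F \<longrightarrow> card F < Suc DIM(real^'n)"
    using bd by (simp add: less_Suc_eq_le)
  ultimately obtain E where E: "P E" and max: "\<And>F. P F \<Longrightarrow> card F \<le> card E"
    using ex_has_greatest_nat[of P "{}" card "Suc DIM(real^'n)"] by blast
  have "card E = CARD('n)"
  proof (rule ccontr)
    assume "card E \<noteq> CARD('n)"
    with bd[OF E] have "card E < DIM(real^'n)" by simp
    then have "dim E < DIM(real^'n)"
      using dim_eq_card_independent[OF indep[OF E]] by simp
    then obtain u where u: "u \<noteq> 0" "\<And>y. y \<in> span E \<Longrightarrow> orthogonal u y"
      by (rule orthogonal_to_subspace_exists) blast
    define U where "U = {y. \<forall>x\<in>E. orthogonal x y}"
    have "S *v y \<in> U" if "y \<in> U" for y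
    proof -
      have "x \<bullet> (S *v y) = 0" if "x \<in> E" for x
      proof -
        obtain l where "S *v x = l *\<^sub>R x" using E \<open>x \<in> E\<close> by (auto simp: P_def)
        then show ?thesis
          using symmetric_inner_mult[OF sym, of x y] \<open>y \<in> U\<close> \<open>x \<in> E\<close>
          by (simp add: U_def orthogonal_def)
      qed
      then show ?thesis by (simp add: U_def orthogonal_def)
    qed
    moreover have "u \<in> U"
      using u by (auto simp: U_def orthogonal_commute span_base)
    moreover have "subspace U"
      unfolding U_def by (rule subspace_orthogonal_to_vectors)
    ultimately obtain v l where v: "v \<in> U" "norm v = 1" "S *v v = l *\<^sub>R v"
      using ex_eigenvector_in_subspace[OF sym] u(1) by metis
    have "v \<notin> E"
      using v by (auto simp: U_def orthogonal_def norm_eq_1)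
    have "P (insert v E)"
      using E v by (auto simp: P_def pairwise_insert U_def orthogonal_commute)
    from max[OF this] show False
      using \<open>v \<notin> E\<close> bd[OF E] by simp
  qed
  \<comment> \<open>Indexing by the coordinate type makes the family the rows of a square
    matrix.\<close>
  then obtain r where r: "bij_betw r (UNIV :: 'n set) E"
    using bd[OF E] by (metis finite_class.finite_UNIV finite_same_card_bij)
  have rE: "r i \<in> E" for i using r by (auto simp: bij_betw_def)
  then have "\<forall>i. \<exists>l. S *v r i = l *\<^sub>R r i"
    using E by (auto simp: P_def)
  then obtain l where "\<And>i. S *v r i = l i *\<^sub>R r i"
    by (subst (asm) choice_iff) blast
  moreover have "r i \<bullet> r j = (if i = j then 1 else 0)" for i j
  proof (cases "i = j")
    case True then show ?thesis using E rE[of j] by (auto simp: P_def norm_eq_1)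
  next
    case False
    then have "r i \<noteq> r j" using r by (auto simp: bij_betw_def inj_on_def)
    then show ?thesis using False E rE[of j] rE[of i] by (auto simp: P_def pairwise_def orthogonal_def)
  qed
  ultimately show ?thesis using that by blast
qed

text \<open>Orthonormality says that the square matrix with rows \<open>r i\<close> has its
  transpose as a right inverse. It is then also a left inverse, and that equation is the
  expansion.\<close>

lemma orthonormal_family_expand:
  fixes r :: "'n \<Rightarrow> real^'n"
  assumes "\<And>i j. r i \<bullet> r j = (if i = j then 1 else 0)"
  shows "(\<Sum>i\<in>UNIV. (r i \<bullet> x) *\<^sub>R r i) = x"
proof -
  define R where "R = (\<chi> i. r i)"
  have "R ** transpose R = mat 1"
    using assms by (simp add: R_def vec_eq_iff matrix_matrix_mult_def transpose_def mat_def inner_vec_def)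
  then have "transpose R ** R = mat 1"
    by (simp add: matrix_left_right_inverse)
  then have "transpose R *v (R *v x) = x"
    by (simp add: matrix_vector_mul_assoc)
  moreover have "transpose R *v y = (\<Sum>i\<in>UNIV. y $ i *\<^sub>R r i)" for y
    by (simp add: matrix_vector_mult_def transpose_def R_def vec_eq_iff mult.commute)
  moreover have "(R *v x) $ i = r i \<bullet> x" for i
    by (simp add: R_def matrix_vector_mult_def inner_vec_def)
  ultimately show ?thesis
    by simp
qed

lemma matrix_eq_on_orthonormal_family:
  fixes r :: "'n \<Rightarrow> real^'n" and A B :: "real^'n^'m"
  assumes "\<And>i j. r i \<bullet> r j = (if i = j then 1 else 0)" "\<And>i. A *v r i = B *v r i"
  shows "A = B"
proof -
  have "A *v x = B *v x" for x
  proof -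
    have "A *v x = A *v (\<Sum>i\<in>UNIV. (r i \<bullet> x) *\<^sub>R r i)"
      using orthonormal_family_expand[OF assms(1)] by simp
    also have "\<dots> = B *v (\<Sum>i\<in>UNIV. (r i \<bullet> x) *\<^sub>R r i)"
      by (simp add: vec.sum matrix_vector_mult_scaleR assms(2) matrix_vector_right_distrib)
    finally show ?thesis
      using orthonormal_family_expand[OF assms(1)] by simp
  qed
  then show ?thesis by (simp add: matrix_eq)
qed

section \<open>Nonnegative definite matrices and their square roots\<close>

lemma nonneg_definite_inner_zero:
  assumes "nonneg_definite A" "v \<bullet> (A *v v) = 0"
  shows "A *v v = 0"
proof -
  have sym: "transpose A = A" using assms by (simp add: nonneg_definite_def)
  \<comment> \<open>Degenerate Cauchy-Schwarz: along v + t A v the nonnegative form has no constant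
    term, and its linear coefficient is twice |A v|^2.\<close>
  have "(A *v v) \<bullet> (A *v v) = 0"
  proof (rule zero_if_quadratic_nonneg)
    fix t :: real
    have "0 \<le> (v + t *\<^sub>R (A *v v)) \<bullet> (A *v (v + t *\<^sub>R (A *v v)))"
      using assms by (simp add: nonneg_definite_def)
    also have "\<dots> = 2 * t * ((A *v v) \<bullet> (A *v v)) + t\<^sup>2 * ((A *v v) \<bullet> (A *v (A *v v)))"
      using assms(2) symmetric_inner_mult[OF sym, of v "A *v v"]
      by (simp add: matrix_vector_right_distrib matrix_vector_mult_scaleR inner_simps
          algebra_simps power2_eq_square)
    finally show "0 \<le> \<dots>" .
  qed
  then show ?thesis by simp
qed

text \<open>Since (B + sqrt l)(B - sqrt l) v = 0, the vector (B - sqrt l) v satisfies the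
  eigenvector equation of \<open>B\<close> for - sqrt l, and nonnegativity forces it to vanish when
  l > 0. For l = 0 that inequality says nothing, and |B v|^2 = v . B^2 v = 0 is used
  instead.\<close>

lemma nnd_sqrt_unique_on_eigenvector:
  fixes B :: "real^'n^'n"
  assumes "nonneg_definite B" "(B ** B) *v v = l *\<^sub>R v" "0 \<le> l"
  shows "B *v v = sqrt l *\<^sub>R v"
proof -
  define w where "w = B *v v - sqrt l *\<^sub>R v"
  have "B *v w = - sqrt l *\<^sub>R w"
    using assms(2,3) by (simp add: w_def matrix_vector_mult_diff_distrib matrix_vector_mult_scaleR
        matrix_vector_mul_assoc algebra_simps)
  have "0 \<le> w \<bullet> (B *v w)" using assms(1) by (simp add: nonneg_definite_def)
  then have *: "sqrt l * (w \<bullet> w) \<le> 0"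
    using \<open>B *v w = _\<close> by simp
  have "w = 0"
  proof (cases "l = 0")
    case True
    have "(B *v v) \<bullet> (B *v v) = v \<bullet> ((B ** B) *v v)"
      using assms(1) symmetric_inner_mult[of B v "B *v v"]
      by (simp add: nonneg_definite_def matrix_vector_mul_assoc)
    then show ?thesis using True assms(2) by (simp add: w_def)
  next
    case False
    then have "sqrt l > 0" using assms by simp
    with * have "w \<bullet> w \<le> 0" by (simp add: mult_le_0_iff)
    then show ?thesis by (metis inner_ge_zero inner_eq_zero_iff order_antisym)
  qed
  then show ?thesis by (simp add: w_def)
qed

text \<open>\<open>nnd_sqrt\<close> is a definite description, so existence alone would say nothing
  about it. Uniqueness comes from testing on an eigenbasis of \<open>A\<close>, where every
  nonnegative definite root must act by sqrt (l i).\<close>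

lemma ex1_nnd_sqrt:
  fixes A :: "real^'n^'n"
  assumes "nonneg_definite A"
  shows "\<exists>!B. nonneg_definite B \<and> B ** B = A"
proof -
  have sym: "transpose A = A" using assms by (simp add: nonneg_definite_def)
  obtain r :: "'n \<Rightarrow> real^'n" and l where r: "\<And>i j. r i \<bullet> r j = (if i = j then 1 else 0)" "\<And>i. A *v r i = l i *\<^sub>R r i"
    using symmetric_orthonormal_eigenbasis[OF sym] by blast
  have l: "l i \<ge> 0" for i
  proof -
    have "0 \<le> r i \<bullet> (A *v r i)" using assms by (simp add: nonneg_definite_def)
    then show ?thesis by (simp add: r)
  qed
  \<comment> \<open>The sum of sqrt (l i) times the orthogonal projection onto \<open>r i\<close>,
    written in entries.\<close>
  define B :: "real^'n^'n" where "B = (\<chi> a b. \<Sum>i\<in>UNIV. sqrt (l i) * (r i $ a) * (r i $ b))"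
  have Bx: "B *v x = (\<Sum>i\<in>UNIV. (sqrt (l i) * (r i \<bullet> x)) *\<^sub>R r i)" for x
  proof (subst vec_eq_iff, intro allI)
    fix a
    have "(B *v x) $ a = (\<Sum>b\<in>UNIV. \<Sum>i\<in>UNIV. sqrt (l i) * (r i $ a) * (r i $ b) * x $ b)"
      by (simp add: B_def matrix_vector_mult_def sum_distrib_right)
    also have "\<dots> = (\<Sum>i\<in>UNIV. \<Sum>b\<in>UNIV. sqrt (l i) * (r i $ a) * (r i $ b) * x $ b)"
      by (rule sum.swap)
    also have "\<dots> = (\<Sum>i\<in>UNIV. (sqrt (l i) * (r i \<bullet> x)) *\<^sub>R r i) $ a"
      by (simp add: inner_vec_def sum_distrib_left sum_distrib_right mult_ac)
    finally show "(B *v x) $ a = (\<Sum>i\<in>UNIV. (sqrt (l i) * (r i \<bullet> x)) *\<^sub>R r i) $ a" .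
  qed
  have Br: "B *v r j = sqrt (l j) *\<^sub>R r j" for j
    by (simp add: Bx r(1) if_distrib[of "\<lambda>x. _ * x"] if_distrib[of "\<lambda>x. x *\<^sub>R _"] cong: if_cong)
  have "transpose B = B"
    by (simp add: B_def transpose_def vec_eq_iff mult_ac)
  moreover have "0 \<le> x \<bullet> (B *v x)" for x
    using l by (auto simp: Bx inner_sum_right inner_commute mult.assoc intro!: sum_nonneg)
  moreover have "B ** B = A"
    by (rule matrix_eq_on_orthonormal_family[OF r(1)])
      (use l in \<open>simp add: matrix_vector_mul_assoc[symmetric] Br matrix_vector_mult_scaleR r(2)\<close>)
  moreover have "C = B" if "nonneg_definite C" "C ** C = A" for C
    by (rule matrix_eq_on_orthonormal_family[OF r(1)])
      (use that l r(2) in \<open>simp add: Br nnd_sqrt_unique_on_eigenvector[OF that(1)]\<close>)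
  ultimately show ?thesis
    unfolding nonneg_definite_def by (intro ex1I[of _ B]) (auto simp: nonneg_definite_def)
qed

lemma nnd_sqrt:
  assumes "nonneg_definite A"
  shows nonneg_definite_nnd_sqrt: "nonneg_definite (nnd_sqrt A)"
    and nnd_sqrt_mult_self: "nnd_sqrt A ** nnd_sqrt A = A"
  using theI'[OF ex1_nnd_sqrt[OF assms]] by (auto simp: nnd_sqrt_def)

text \<open>An eigenvector of \<open>V + Q\<close> with eigenvalue \<open>0\<close> is killed by both forms, any other one lies in
  the range of \<open>Q\<close>; so the spectral theorem for \<open>V + Q\<close> diagonalizes both at once.\<close>

lemma simultaneous_diagonalization:
  fixes Q V :: "real^'n^'n"
  assumes nnd: "nonneg_definite Q" "nonneg_definite V"
    and QQ: "Q ** Q = Q" and QV: "Q ** V = V" and VQ: "V ** Q = V"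
  obtains r :: "'n \<Rightarrow> real^'n" and d :: "'n \<Rightarrow> real" and I :: "'n set"
  where "\<And>i j. r i \<bullet> r j = (if i = j then 1 else 0)"
    and "\<And>x. x \<bullet> (Q *v x) = (\<Sum>i\<in>I. (r i \<bullet> x)\<^sup>2)"
    and "\<And>x. x \<bullet> (V *v x) = (\<Sum>i\<in>I. d i * (r i \<bullet> x)\<^sup>2)"
    and "card I = rank Q" and "trace V = (\<Sum>i\<in>I. d i)"
proof -
  have "transpose (V + Q) = V + Q"
    using nnd by (simp add: nonneg_definite_def vec_eq_iff transpose_def)
  then obtain r :: "'n \<Rightarrow> real^'n" and l where r: "\<And>i j. r i \<bullet> r j = (if i = j then 1 else 0)"
    and l: "\<And>i. (V + Q) *v r i = l i *\<^sub>R r i"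
    using symmetric_orthonormal_eigenbasis by blast
  define I where "I = {i. l i \<noteq> 0}"
  \<comment> \<open>On each \<open>r i\<close> with i in \<open>I\<close> the matrix
    \<open>Q\<close> will turn out to act as the identity, so \<open>V\<close> accounts for the rest
    of the eigenvalue of V + Q.\<close>
  define d where "d i = l i - 1" for i
  have sum_r: "V *v r i + Q *v r i = l i *\<^sub>R r i" for i
    using l[of i] by (simp add: matrix_vector_mult_add_rdistrib)
  have zero: "Q *v r i = 0 \<and> V *v r i = 0" if "i \<notin> I" for i
  proof -
    \<comment> \<open>Two nonnegative values with sum zero both vanish. This gives Q r = 0, and then
      V r = V Q r = 0.\<close>
    have "r i \<bullet> (V *v r i) + r i \<bullet> (Q *v r i) = 0"
      using sum_r[of i] that by (simp add: I_def flip: inner_add_right)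
    moreover have "0 \<le> r i \<bullet> (V *v r i)" "0 \<le> r i \<bullet> (Q *v r i)"
      using nnd by (auto simp: nonneg_definite_def)
    ultimately have "r i \<bullet> (Q *v r i) = 0" by linarith
    then have "Q *v r i = 0"
      by (rule nonneg_definite_inner_zero[OF nnd(1)])
    then show ?thesis
      using VQ by (metis matrix_vector_mul_assoc matrix_vector_mult_0_right)
  qed
  have one: "Q *v r i = r i \<and> V *v r i = d i *\<^sub>R r i" if "i \<in> I" for i
  proof -
    \<comment> \<open>\<open>Q\<close> fixes everything in the range of V + Q, because QV = V and QQ
      = Q; the nonzero factor l i cancels.\<close>
    have "l i *\<^sub>R (Q *v r i) = Q *v (V *v r i + Q *v r i)"
      by (simp add: sum_r matrix_vector_mult_scaleR)
    also have "\<dots> = V *v r i + Q *v r i"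
      by (simp add: matrix_vector_right_distrib matrix_vector_mul_assoc QV QQ)
    also note sum_r
    finally have "Q *v r i = r i"
      using that by (simp add: I_def)
    with sum_r[of i] have "V *v r i = l i *\<^sub>R r i - r i"
      by (simp add: eq_diff_eq)
    with \<open>Q *v r i = r i\<close> show ?thesis
      by (simp add: d_def scaleR_left_diff_distrib)
  qed
  have expand: "(\<Sum>i\<in>UNIV. (r i \<bullet> x) *\<^sub>R (M *v r i)) = M *v x" for x and M :: "real^'n^'n"
  proof -
    have "M *v x = M *v (\<Sum>i\<in>UNIV. (r i \<bullet> x) *\<^sub>R r i)"
      using orthonormal_family_expand[OF r] by simp
    then show ?thesis
      by (simp add: vec.sum matrix_vector_mult_scaleR)
  qed
  have Qx: "Q *v x = (\<Sum>i\<in>I. (r i \<bullet> x) *\<^sub>R r i)" for x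
    unfolding expand[of x Q, symmetric] by (rule sum.mono_neutral_cong_right) (auto simp: zero one)
  have Vx: "V *v x = (\<Sum>i\<in>I. (d i * (r i \<bullet> x)) *\<^sub>R r i)" for x
    unfolding expand[of x V, symmetric] by (rule sum.mono_neutral_cong_right) (auto simp: zero one mult.commute)
  have "range ((*v) Q) = span (r ` I)"
  proof
    show "range ((*v) Q) \<subseteq> span (r ` I)"
    proof
      fix y assume "y \<in> range ((*v) Q)"
      then obtain x where "y = Q *v x" by blast
      then have "y = (\<Sum>i\<in>I. (r i \<bullet> x) *\<^sub>R r i)" by (simp only: Qx)
      then show "y \<in> span (r ` I)"
        by (simp only:) (intro span_sum span_scale span_base imageI)
    qed
    have "subspace (range ((*v) Q))"
      by (intro linear_subspace_image matrix_vector_mul_linear subspace_UNIV)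
    moreover have "r ` I \<subseteq> range ((*v) Q)"
      using one by (metis image_subsetI rangeI)
    ultimately show "span (r ` I) \<subseteq> range ((*v) Q)"
      by (rule span_minimal[rotated])
  qed
  moreover have "inj_on r I"
    using r by (metis inj_onI one_neq_zero)
  moreover have "independent (r ` I)"
    using r by (intro pairwise_orthogonal_independent) (force simp: pairwise_def orthogonal_def, metis image_iff inner_zero_left one_neq_zero)
  ultimately have "card I = rank Q"
    by (simp add: rank_dim_range card_image dim_eq_card_independent)
  moreover have "trace V = (\<Sum>i\<in>I. d i)"
  proof -
    have "V $ a $ a = (\<Sum>i\<in>I. d i * (r i $ a * r i $ a))" for a
    proof -
      have "V $ a $ a = (V *v axis a 1) $ a"
        by (simp add: matrix_vector_mult_basis column_def)
      then show ?thesis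
        by (simp add: Vx inner_axis mult.assoc)
    qed
    then have "trace V = (\<Sum>i\<in>I. \<Sum>a\<in>UNIV. d i * (r i $ a * r i $ a))"
      unfolding trace_def by (simp add: sum.swap[of _ I])
    also have "\<dots> = (\<Sum>i\<in>I. d i * (r i \<bullet> r i))"
      by (simp add: inner_vec_def sum_distrib_left)
    finally show ?thesis by (simp add: r)
  qed
  ultimately show ?thesis
    by (intro that[of r I d]) (auto simp: r Qx Vx inner_sum_right inner_commute power2_eq_square mult.assoc)
qed

section \<open>Rotation invariance\<close>

lemma nn_integral_lborel_shift:
  fixes f :: "'a::euclidean_space \<Rightarrow> ennreal"
  assumes [measurable]: "f \<in> borel_measurable borel"
  shows "(\<integral>\<^sup>+x. f (c + x) \<partial>lborel) = (\<integral>\<^sup>+x. f x \<partial>lborel)"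
proof -
  have "(\<integral>\<^sup>+x. f x \<partial>lborel) = (\<integral>\<^sup>+x. f x \<partial>distr lborel borel ((+) c))"
    by (simp add: lborel_distr_plus)
  also have "\<dots> = (\<integral>\<^sup>+x. f (c + x) \<partial>lborel)"
    by (subst nn_integral_distr) auto
  finally show ?thesis ..
qed

text \<open>Uniqueness of Haar measure in miniature: \<open>\<integral>\<integral> 1\<^sub>A(f x + y) 1\<^sub>B(y) dx dy\<close>, with \<open>B\<close> the unit ball,
  is evaluated in both orders. This works for every index type, whereas the library's
  \<open>measure_orthogonal_image\<close> needs a well-ordered one.\<close>

lemma lborel_distr_orthogonal:
  fixes f :: "'a::euclidean_space \<Rightarrow> 'a"
  assumes f: "orthogonal_transformation f"
  shows "distr lborel borel f = lborel"
proof (rule measure_eqI)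
  fix A assume "A \<in> sets (distr lborel borel f)"
  then have [measurable]: "A \<in> sets borel" by simp
  have lin: "linear f" using f by (rule orthogonal_transformation_linear)
  have [measurable]: "f \<in> borel_measurable borel"
    using lin by (intro borel_measurable_continuous_onI linear_continuous_on)
      (simp add: linear_conv_bounded_linear)
  define B where "B = ball (0::'a) 1"
  have [measurable]: "B \<in> sets borel" by (simp add: B_def)
  have surj: "\<exists>x. f x = y" for y
    using orthogonal_transformation_surj[OF f] by (metis surjD)
  define I where "I = (\<integral>\<^sup>+x. \<integral>\<^sup>+y. indicator A (f x + y) * indicator B y \<partial>lborel \<partial>lborel)"
  have "I = (\<integral>\<^sup>+y. \<integral>\<^sup>+x. indicator A (f x + y) * indicator B y \<partial>lborel \<partial>lborel)"
    unfolding I_def by (rule lborel_pair.Fubini'[symmetric]) simp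
  also have "\<dots> = (\<integral>\<^sup>+y. (\<integral>\<^sup>+x. indicator A (f x) \<partial>lborel) * indicator B y \<partial>lborel)"
  proof (rule nn_integral_cong)
    fix y
    \<comment> \<open>Writing y as f z turns adding y into translating x by z, which Lebesgue
      measure does not notice.\<close>
    obtain z where "f z = y" using surj by blast
    then have "f x + y = f (z + x)" for x
      using linear_add[OF lin, of z x] by (simp add: add.commute)
    then have "(\<integral>\<^sup>+x. indicator A (f x + y) * indicator B y \<partial>lborel)
        = (\<integral>\<^sup>+x. indicator A (f (z + x)) \<partial>lborel) * indicator B y"
      by (simp add: nn_integral_multc)
    also have "(\<integral>\<^sup>+x. indicator A (f (z + x)) \<partial>lborel) = (\<integral>\<^sup>+x. indicator A (f x) \<partial>lborel)"
      by (rule nn_integral_lborel_shift[of "\<lambda>x. indicator A (f x)"]) simp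
    finally show "(\<integral>\<^sup>+x. indicator A (f x + y) * indicator B y \<partial>lborel)
       = (\<integral>\<^sup>+x. indicator A (f x) \<partial>lborel) * indicator B y" .
  qed
  also have "\<dots> = (\<integral>\<^sup>+x. indicator A x \<partial>distr lborel borel f) * emeasure lborel B"
    by (simp add: nn_integral_cmult nn_integral_distr del: nn_integral_indicator) simp
  also have "(\<integral>\<^sup>+x. indicator A x \<partial>distr lborel borel f) = emeasure (distr lborel borel f) A"
    by simp
  finally have 1: "I = emeasure (distr lborel borel f) A * emeasure lborel B" .
  have "I = (\<integral>\<^sup>+x. \<integral>\<^sup>+y. indicator A y * indicator B (y - f x) \<partial>lborel \<partial>lborel)"
    unfolding I_def
  proof (rule nn_integral_cong)
    fix x
    show "(\<integral>\<^sup>+y. indicator A (f x + y) * indicator B y \<partial>lborel) =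
      (\<integral>\<^sup>+y. indicator A y * indicator B (y - f x) \<partial>lborel)"
      using nn_integral_lborel_shift[of "\<lambda>y. indicator A y * indicator B (y - f x)" "f x"] by simp
  qed
  also have "\<dots> = (\<integral>\<^sup>+y. \<integral>\<^sup>+x. indicator A y * indicator B (y - f x) \<partial>lborel \<partial>lborel)"
    by (rule lborel_pair.Fubini'[symmetric]) simp
  also have "\<dots> = (\<integral>\<^sup>+y. indicator A y * emeasure lborel B \<partial>lborel)"
  proof (rule nn_integral_cong)
    fix y
    obtain z where z: "f z = y" using surj by blast
    \<comment> \<open>Because f preserves norms and y = f z, the condition |y - f x| < 1 becomes |x
      - z| < 1.\<close>
    have "indicator B (y - f x) = (indicator B (- z + x) :: ennreal)" for x
    proof -
      have "norm (y - f x) = norm (z - x)"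
        using linear_diff[OF lin, of z x] orthogonal_transformation_norm[OF f] z by metis
      then show ?thesis by (simp add: B_def indicator_def norm_minus_commute)
    qed
    then have "(\<integral>\<^sup>+x. indicator A y * indicator B (y - f x) \<partial>lborel)
        = indicator A y * (\<integral>\<^sup>+x. indicator B (- z + x) \<partial>lborel)"
      by (simp add: nn_integral_cmult)
    also have "(\<integral>\<^sup>+x. indicator B (- z + x) \<partial>lborel) = emeasure lborel B"
      by (subst nn_integral_lborel_shift) auto
    finally show "(\<integral>\<^sup>+x. indicator A y * indicator B (y - f x) \<partial>lborel)
        = indicator A y * emeasure lborel B" .
  qed
  also have "\<dots> = emeasure lborel A * emeasure lborel B"
    by (simp add: nn_integral_multc)
  finally have 2: "I = emeasure lborel A * emeasure lborel B" .
  \<comment> \<open>Cancelling the ball in \<open>ennreal\<close> requires its measure to be neither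
    0 nor infinite.\<close>
  have "0 < measure lborel B"
    unfolding B_def by (simp add: content_ball_pos)
  then have "emeasure lborel B \<noteq> 0"
    by (auto simp: measure_def)
  moreover have "emeasure lborel B \<noteq> \<infinity>"
    using emeasure_lborel_ball_finite[of "0::'a" 1] by (simp add: B_def)
  ultimately show "emeasure (distr lborel borel f) A = emeasure lborel A"
    using 1 2 by (metis ennreal_mult_cancel_left mult.commute infinity_ennreal_def)
qed simp

text \<open>Connects the coordinate product, in which \<open>normal_id\<close> is built, with
  Lebesgue measure on the vector type, where rotations act. Box volumes determine the
  latter.\<close>

lemma lborel_vec_eq_distr_PiM:
  "(lborel :: (real^'n) measure) = distr (\<Pi>\<^sub>M i\<in>(UNIV::'n set). lborel) borel (\<lambda>z. \<chi> i. z i)"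
proof (rule lborel_eqI)
  interpret product_sigma_finite "\<lambda>_::'n. lborel :: real measure" ..
  have meas[measurable]: "(\<lambda>z. (\<chi> i. z i) :: real^'n) \<in> borel_measurable (\<Pi>\<^sub>M i\<in>(UNIV::'n set). (lborel::real measure))"
    by (subst borel_measurable_euclidean_space) (auto simp: Basis_vec_def inner_axis)
  fix l u :: "real^'n"
  assume le': "\<And>b. b \<in> Basis \<Longrightarrow> l \<bullet> b \<le> u \<bullet> b"
  have le: "l $ i \<le> u $ i" for i
    using le'[of "axis i 1"] by (simp add: inner_axis axis_in_Basis_iff)
  have vim: "(\<lambda>z. (\<chi> i. z i) :: real^'n) -` box l u \<inter> space (\<Pi>\<^sub>M i\<in>(UNIV::'n set). (lborel::real measure))
      = Pi\<^sub>E UNIV (\<lambda>i. {l $ i<..<u $ i})"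
    by (auto simp: mem_box_cart space_PiM PiE_def Pi_iff)
  have "emeasure (distr (\<Pi>\<^sub>M i\<in>(UNIV::'n set). lborel) borel (\<lambda>z. (\<chi> i. z i) :: real^'n)) (box l u)
      = (\<Prod>i\<in>UNIV. emeasure lborel {l $ i<..<u $ i})"
    by (subst emeasure_distr[OF meas]) (simp_all add: vim emeasure_PiM)
  also have "\<dots> = (\<Prod>i\<in>UNIV. ennreal (u $ i - l $ i))"
    using le by simp
  also have "\<dots> = (\<Prod>i\<in>UNIV. u $ i - l $ i)"
    using le by (simp add: prod_ennreal)
  also have "(\<Prod>i\<in>UNIV. u $ i - l $ i) = (\<Prod>b\<in>Basis. (u - l) \<bullet> b)"
  proof -
    have "bij_betw (\<lambda>i. axis i 1) (UNIV :: 'n set) (Basis :: (real^'n) set)"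
      by (auto simp: bij_betw_def inj_on_def axis_eq_axis Basis_vec_def)
    from prod.reindex_bij_betw[OF this, of "\<lambda>b. (u - l) \<bullet> b"]
    show ?thesis
      by (simp add: inner_axis)
  qed
  finally show "emeasure (distr (\<Pi>\<^sub>M i\<in>(UNIV::'n set). lborel) borel (\<lambda>z. (\<chi> i. z i) :: real^'n)) (box l u)
     = (\<Prod>b\<in>Basis. (u - l) \<bullet> b)" .
qed simp

section \<open>Normal vectors with identity covariance\<close>

definition normal_vec :: "real^'n \<Rightarrow> (real^'n) measure" where
  "normal_vec m = distr (normal_id UNIV (\<lambda>i. m $ i)) borel (\<lambda>z. \<chi> i. z i)"

lemma measurable_vec_lambda_normal_id:
  "(\<lambda>z. (\<chi> i. z i) :: real^'n) \<in> borel_measurable (normal_id UNIV \<theta>)"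
  using measurable_mvnormal_map[of 0 "mat 1" \<theta>] by simp

text \<open>On a box both the density and the indicator factor over the coordinates, and boxes
  determine the product measure.\<close>

lemma normal_id_eq_density:
  assumes "finite J"
  shows "normal_id J m = density (\<Pi>\<^sub>M i\<in>J. lborel) (\<lambda>z. ennreal (\<Prod>i\<in>J. normal_density (m i) 1 (z i)))"
proof -
  interpret L: product_sigma_finite "\<lambda>_. lborel :: real measure" ..
  interpret N: product_sigma_finite "\<lambda>i. density lborel (normal_density (m i) 1)"
    by (simp add: product_sigma_finite_def prob_space_imp_sigma_finite prob_space_normal_density)
  show ?thesis
    unfolding normal_id_def
  proof (rule N.PiM_eqI[symmetric, OF assms])
    show "sets (density (Pi\<^sub>M J (\<lambda>i. lborel)) (\<lambda>z. ennreal (\<Prod>i\<in>J. normal_density (m i) 1 (z i))))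
      = sets (\<Pi>\<^sub>M i\<in>J. density lborel (\<lambda>x. ennreal (normal_density (m i) 1 x)))"
      unfolding sets_density by (rule sets_PiM_cong) auto
    fix A assume "\<And>i. i \<in> J \<Longrightarrow> A i \<in> sets (density lborel (\<lambda>x. ennreal (normal_density (m i) 1 x)))"
    then have A[measurable]: "i \<in> J \<Longrightarrow> A i \<in> sets borel" for i by simp
    have "Pi\<^sub>E J A \<in> sets (Pi\<^sub>M J (\<lambda>i. lborel))"
      using assms A by (intro sets_PiM_I_finite) auto
    then have "emeasure (density (Pi\<^sub>M J (\<lambda>i. lborel)) (\<lambda>z. ennreal (\<Prod>i\<in>J. normal_density (m i) 1 (z i)))) (Pi\<^sub>E J A)
      = (\<integral>\<^sup>+z. ennreal (\<Prod>i\<in>J. normal_density (m i) 1 (z i)) * indicator (Pi\<^sub>E J A) z \<partial>Pi\<^sub>M J (\<lambda>i. lborel))"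
      using assms by (intro emeasure_density) auto
    also have "\<dots> = (\<integral>\<^sup>+z. (\<Prod>i\<in>J. ennreal (normal_density (m i) 1 (z i)) * indicator (A i) (z i)) \<partial>Pi\<^sub>M J (\<lambda>i. lborel))"
    proof (rule nn_integral_cong)
      fix z :: "_ \<Rightarrow> real" assume z: "z \<in> space (Pi\<^sub>M J (\<lambda>i. lborel))"
      have "indicator (Pi\<^sub>E J A) z = (\<Prod>i\<in>J. indicator (A i) (z i) :: ennreal)"
      proof (cases "\<forall>i\<in>J. z i \<in> A i")
        case True
        then show ?thesis using z by (auto simp: space_PiM PiE_def Pi_iff)
      next
        case False
        then show ?thesis using assms by (auto simp: PiE_def Pi_iff indicator_def prod_zero_iff)
      qed
      then show "ennreal (\<Prod>i\<in>J. normal_density (m i) 1 (z i)) * indicator (Pi\<^sub>E J A) z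
        = (\<Prod>i\<in>J. ennreal (normal_density (m i) 1 (z i)) * indicator (A i) (z i))"
        by (simp add: prod.distrib prod_ennreal)
    qed
    also have "\<dots> = (\<Prod>i\<in>J. \<integral>\<^sup>+x. ennreal (normal_density (m i) 1 x) * indicator (A i) x \<partial>lborel)"
      using assms A L.product_nn_integral_prod[of J "\<lambda>i x. ennreal (normal_density (m i) 1 x) * indicator (A i) x"]
      by simp
    also have "\<dots> = (\<Prod>i\<in>J. emeasure (density lborel (\<lambda>x. ennreal (normal_density (m i) 1 x))) (A i))"
      using A by (intro prod.cong refl emeasure_density[symmetric]) auto
    finally show "emeasure (density (Pi\<^sub>M J (\<lambda>i. lborel)) (\<lambda>z. ennreal (\<Prod>i\<in>J. normal_density (m i) 1 (z i)))) (Pi\<^sub>E J A)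
      = (\<Prod>i\<in>J. emeasure (density lborel (\<lambda>x. ennreal (normal_density (m i) 1 x))) (A i))" .
  qed
qed

text \<open>The point of this form is that the density depends on x only through its distance to the
  mean, which isometries preserve.\<close>

lemma normal_vec_eq_density:
  fixes m :: "real^'n"
  shows "normal_vec m = density lborel (\<lambda>x. ennreal ((1 / sqrt (2 * pi)) ^ CARD('n) * exp (- (dist x m)\<^sup>2 / 2)))"
proof -
  have [measurable]: "(\<lambda>z. (\<chi> i. z i) :: real^'n) \<in> Pi\<^sub>M UNIV (\<lambda>i. lborel) \<rightarrow>\<^sub>M borel"
    by (subst borel_measurable_euclidean_space) (auto simp: Basis_vec_def inner_axis)
  have prod: "(\<Prod>i\<in>UNIV. normal_density (m $ i) 1 (x $ i)) = (1 / sqrt (2 * pi)) ^ CARD('n) * exp (- (dist x m)\<^sup>2 / 2)"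
    for x :: "real^'n"
  proof -
    have "(dist x m)\<^sup>2 = (\<Sum>i\<in>UNIV. (x $ i - m $ i)\<^sup>2)"
      unfolding dist_norm power2_norm_eq_inner by (simp add: inner_vec_def power2_eq_square)
    then show ?thesis
      by (simp add: normal_density_def prod.distrib exp_sum[symmetric] sum_negf
          sum_divide_distrib[symmetric] prod_dividef power_one_over)
  qed
  have "normal_vec m = distr (density (Pi\<^sub>M UNIV (\<lambda>i. lborel))
     (\<lambda>z. ennreal ((1 / sqrt (2 * pi)) ^ CARD('n) * exp (- (dist (\<chi> i. z i) m)\<^sup>2 / 2)))) borel (\<lambda>z. \<chi> i. z i)"
    using prod[of "\<chi> i. z i" for z] by (simp only: normal_vec_def normal_id_eq_density finite vec_lambda_beta)
  also have "\<dots> = density (distr (Pi\<^sub>M UNIV (\<lambda>i. lborel)) borel (\<lambda>z. \<chi> i. z i))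
     (\<lambda>x. ennreal ((1 / sqrt (2 * pi)) ^ CARD('n) * exp (- (dist x m)\<^sup>2 / 2)))"
    by (rule density_distr[symmetric]) auto
  finally show ?thesis
    by (simp flip: lborel_vec_eq_distr_PiM)
qed

text \<open>The density at x around m equals the density at f x around f m, so it passes through the
  push-forward once f preserves Lebesgue measure. Translations and orthogonal maps are the two
  instances.\<close>

lemma distr_normal_vec_isometry:
  fixes f :: "real^'n \<Rightarrow> real^'n"
  assumes [measurable]: "f \<in> borel_measurable borel" and "distr lborel borel f = lborel"
    and iso: "\<And>x y. dist (f x) (f y) = dist x y"
  shows "distr (normal_vec m) borel f = normal_vec (f m)"
proof -
  have "distr (normal_vec m) borel f = distr (density lborel
     (\<lambda>x. ennreal ((1 / sqrt (2 * pi)) ^ CARD('n) * exp (- (dist (f x) (f m))\<^sup>2 / 2)))) borel f"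
    by (simp add: normal_vec_eq_density iso)
  also have "\<dots> = density (distr lborel borel f)
     (\<lambda>x. ennreal ((1 / sqrt (2 * pi)) ^ CARD('n) * exp (- (dist x (f m))\<^sup>2 / 2)))"
    by (rule density_distr[symmetric]) auto
  finally show ?thesis
    by (simp add: assms(2) normal_vec_eq_density)
qed

lemma distr_normal_vec_shift:
  "distr (normal_vec m) borel ((+) c) = normal_vec (c + m)"
  by (rule distr_normal_vec_isometry) (auto simp: lborel_distr_plus dist_norm)

lemma distr_normal_vec_orthogonal:
  fixes f :: "real^'n \<Rightarrow> real^'n"
  assumes "orthogonal_transformation f"
  shows "distr (normal_vec m) borel f = normal_vec (f m)"
proof (rule distr_normal_vec_isometry)
  have "linear f" using assms by (rule orthogonal_transformation_linear)
  then show "f \<in> borel_measurable borel"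
    by (intro borel_measurable_continuous_onI linear_continuous_on) (simp add: linear_conv_bounded_linear)
  show "dist (f x) (f y) = dist x y" for x y
    using \<open>linear f\<close> orthogonal_transformation_norm[OF assms]
    by (simp add: dist_norm flip: linear_diff)
qed (rule lborel_distr_orthogonal[OF assms])

lemma mvnormal_eq_distr_normal_vec:
  "mvnormal \<mu> S = distr (normal_vec 0) borel (\<lambda>x. \<mu> + nnd_sqrt S *v x)"
proof -
  have "(\<lambda>x. \<mu> + nnd_sqrt S *v x) \<in> borel_measurable borel"
    by (intro borel_measurable_continuous_onI continuous_on_add continuous_on_const
        matrix_vector_mult_linear_continuous_on)
  then show ?thesis
    using distr_distr[OF _ measurable_vec_lambda_normal_id[of "\<lambda>_. 0"], of "\<lambda>x. \<mu> + nnd_sqrt S *v x" borel]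
    by (simp add: mvnormal_def normal_vec_def comp_def)
qed

text \<open>The map from coefficients to combinations of the \<open>r i\<close> is orthogonal and
  sends the coefficients r i . \<theta> to \<theta>. Hence the coordinates of the vector in any
  orthonormal basis are independent unit normals.\<close>

lemma normal_vec_eq_distr_orthonormal_family:
  fixes r :: "'n \<Rightarrow> real^'n"
  assumes r: "\<And>i j. r i \<bullet> r j = (if i = j then 1 else 0)"
  shows "normal_vec \<theta> = distr (normal_id UNIV (\<lambda>i. r i \<bullet> \<theta>)) borel (\<lambda>z. \<Sum>i\<in>UNIV. z i *\<^sub>R r i)"
proof -
  define f where "f y = (\<Sum>i\<in>UNIV. y $ i *\<^sub>R r i)" for y :: "real^'n"
  have "f v \<bullet> f w = v \<bullet> w" for v w
  proof -
    have "f v \<bullet> f w = (\<Sum>i\<in>UNIV. v $ i * w $ i)"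
      by (simp add: f_def inner_sum_left inner_sum_right r mult.commute
          if_distrib[of "\<lambda>x. _ * x"] cong: if_cong)
    then show ?thesis by (simp add: inner_vec_def)
  qed
  moreover have "linear f"
    by (auto simp: f_def linear_iff scaleR_add_left sum.distrib scaleR_sum_right)
  ultimately have "orthogonal_transformation f"
    by (simp add: orthogonal_transformation_def)
  then have "distr (normal_vec (\<chi> i. r i \<bullet> \<theta>)) borel f = normal_vec (f (\<chi> i. r i \<bullet> \<theta>))"
    by (rule distr_normal_vec_orthogonal)
  also have "f (\<chi> i. r i \<bullet> \<theta>) = \<theta>"
    using orthonormal_family_expand[OF r] by (simp add: f_def)
  also have "f \<in> borel_measurable borel"
    unfolding f_def by measurable
  then have "distr (normal_vec (\<chi> i. r i \<bullet> \<theta>)) borel f =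
    distr (normal_id UNIV (\<lambda>i. r i \<bullet> \<theta>)) borel (\<lambda>z. \<Sum>i\<in>UNIV. z i *\<^sub>R r i)"
    using distr_distr[OF _ measurable_vec_lambda_normal_id[of "\<lambda>i. r i \<bullet> \<theta>"], of f borel]
    by (simp add: normal_vec_def comp_def f_def)
  finally show ?thesis ..
qed

section \<open>Laplace transforms\<close>

text \<open>Under \<open>x \<mapsto> exp (- x)\<close> the hypothesis becomes equality of all moments of measures on \<open>[0,1]\<close>.\<close>

lemma laplace_transform_unique:
  fixes M N :: "real measure"
  assumes M: "sets M = sets borel" "emeasure M UNIV < \<infinity>" "AE x in M. 0 \<le> x"
    and N: "sets N = sets borel" "AE x in N. 0 \<le> x"
    and eq: "\<And>n::nat. (\<integral>\<^sup>+x. ennreal (exp (- (real n * x))) \<partial>M) = (\<integral>\<^sup>+x. ennreal (exp (- (real n * x))) \<partial>N)"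
  shows "M = N"
proof -
  note [measurable_cong] = M(1) N(1)
  have spM: "space M = UNIV" "space N = UNIV"
    using sets_eq_imp_space_eq[OF M(1)] sets_eq_imp_space_eq[OF N(1)] by auto
  \<comment> \<open>The case n = 0 of \<open>eq\<close> compares the total masses.\<close>
  have "emeasure N UNIV < \<infinity>"
    using eq[of 0] M(2) by (simp add: spM)
  interpret M: finite_measure M using M(2) by (intro finite_measureI) (auto simp: spM)
  interpret N: finite_measure N using \<open>emeasure N UNIV < \<infinity>\<close> by (intro finite_measureI) (auto simp: spM)
  have bdd: "exp (- x) ^ n \<le> 1" if "0 \<le> x" for n and x :: real
    using that by (intro power_le_one) auto
  have powM: "integrable M (\<lambda>x. (exp (- x))^n)" and powN: "integrable N (\<lambda>x. (exp (- x))^n)" for n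
    using M(3) N(2) bdd
    by (auto intro!: M.integrable_const_bound[where B=1] N.integrable_const_bound[where B=1])
  have exp_pow: "exp (- x) ^ n = exp (- (real n * x))" for n and x :: real
    by (simp add: exp_of_nat_mult[symmetric])
  have pow: "(\<integral>x. (exp (- x))^n \<partial>M) = (\<integral>x. (exp (- x))^n \<partial>N)" for n
    using eq[of n] nn_integral_eq_integral[OF powM, of n] nn_integral_eq_integral[OF powN, of n]
    by (simp add: exp_pow integral_nonneg_AE)
  have poly: "integrable M (\<lambda>x. g (exp (- x))) \<and> integrable N (\<lambda>x. g (exp (- x))) \<and>
       (\<integral>x. g (exp (- x)) \<partial>M) = (\<integral>x. g (exp (- x)) \<partial>N)" if "real_polynomial_function g" for g
  proof -
    have "\<exists>a n. g = (\<lambda>x. \<Sum>i\<le>n. a i * x ^ i)"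
      using that by (simp only: real_polynomial_function_iff_sum)
    then obtain a n where g: "g = (\<lambda>x. \<Sum>i\<le>n. a i * x ^ i)"
      by (elim exE)
    have "(\<integral>x. g (exp (- x)) \<partial>M) = (\<Sum>i\<le>n. a i * (\<integral>x. (exp (- x))^i \<partial>M))"
      unfolding g using powM by (subst Bochner_Integration.integral_sum) auto
    also have "\<dots> = (\<Sum>i\<le>n. a i * (\<integral>x. (exp (- x))^i \<partial>N))"
      by (simp only: pow)
    also have "\<dots> = (\<integral>x. g (exp (- x)) \<partial>N)"
      unfolding g using powN by (subst Bochner_Integration.integral_sum) auto
    finally show ?thesis
      unfolding g using powM powN by auto
  qed
  have cont: "integrable M (\<lambda>x. f (exp (- x))) \<and> integrable N (\<lambda>x. f (exp (- x))) \<and>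
       (\<integral>x. f (exp (- x)) \<partial>M) = (\<integral>x. f (exp (- x)) \<partial>N)"
    if f: "continuous_on UNIV f" for f :: "real \<Rightarrow> real"
  proof -
    have [measurable]: "f \<in> borel_measurable borel"
      using f by (rule borel_measurable_continuous_onI)
    \<comment> \<open>Only values of \<open>f\<close> on [0,1] matter, since x is nonnegative almost
      everywhere under both measures.\<close>
    have f': "continuous_on {0..1} f" using f continuous_on_subset by blast
    then have "bounded (f ` {0..1})"
      using compact_continuous_image compact_imp_bounded by blast
    then obtain C where "\<forall>y\<in>{0..1}. norm (f y) \<le> C"
      unfolding bounded_iff by blast
    then have C: "norm (f (exp (- x))) \<le> C" if "0 \<le> x" for x
      using that by auto
    have intM: "integrable M (\<lambda>x. f (exp (- x)))"
      using M(3) C by (intro M.integrable_const_bound[where B=C]) auto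
    have intN: "integrable N (\<lambda>x. f (exp (- x)))"
      using N(2) C by (intro N.integrable_const_bound[where B=C]) auto
    have "\<bar>(\<integral>x. f (exp (- x)) \<partial>M) - (\<integral>x. f (exp (- x)) \<partial>N)\<bar> \<le> e * (measure M UNIV + measure N UNIV)"
      if "e > 0" for e
    proof -
      \<comment> \<open>A polynomial within e of \<open>f\<close> on [0,1] changes each integral by
        at most e times the total mass, and its own two integrals agree.\<close>
      obtain g where g: "real_polynomial_function g" "\<And>y. y \<in> {0..1} \<Longrightarrow> \<bar>f y - g y\<bar> < e"
        using Stone_Weierstrass_real_polynomial_function[OF _ f' \<open>e > 0\<close>] by auto
      have fg: "\<bar>f (exp (- x)) - g (exp (- x))\<bar> \<le> e" if "0 \<le> x" for x
        using g(2)[of "exp (- x)"] that by auto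
      have "\<bar>(\<integral>x. f (exp (- x)) - g (exp (- x)) \<partial>M)\<bar> \<le> (\<integral>x. e \<partial>M)"
        using M(3) fg intM poly[OF g(1)]
        by (intro integral_abs_bound[THEN order_trans] integral_mono_AE) auto
      moreover have "\<bar>(\<integral>x. f (exp (- x)) - g (exp (- x)) \<partial>N)\<bar> \<le> (\<integral>x. e \<partial>N)"
        using N(2) fg intN poly[OF g(1)]
        by (intro integral_abs_bound[THEN order_trans] integral_mono_AE) auto
      ultimately show ?thesis
        using poly[OF g(1)] intM intN by (simp add: spM algebra_simps abs_le_iff)
    qed
    note bound = this
    have "\<bar>(\<integral>x. f (exp (- x)) \<partial>M) - (\<integral>x. f (exp (- x)) \<partial>N)\<bar> \<le> 0"
    proof (rule field_le_epsilon)
      fix e :: real assume "e > 0"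
      define c where "c = measure M UNIV + measure N UNIV"
      have "c \<ge> 0" by (simp add: c_def)
      \<comment> \<open>The denominator c + 1 also covers c = 0.\<close>
      have "\<bar>(\<integral>x. f (exp (- x)) \<partial>M) - (\<integral>x. f (exp (- x)) \<partial>N)\<bar> \<le> e / (c + 1) * c"
        using bound[of "e / (c + 1)"] \<open>e > 0\<close> \<open>c \<ge> 0\<close> by (simp flip: c_def)
      also have "\<dots> = e * (c / (c + 1))" by simp
      also have "\<dots> \<le> e * 1"
        using \<open>e > 0\<close> \<open>c \<ge> 0\<close> by (intro mult_left_mono) auto
      finally show "\<bar>(\<integral>x. f (exp (- x)) \<partial>M) - (\<integral>x. f (exp (- x)) \<partial>N)\<bar> \<le> 0 + e" by simp
    qed
    then show ?thesis using intM intN by simp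
  qed
  have "measure M {..a} = measure N {..a}" for a
  proof -
    \<comment> \<open>For k > 0 a ramp that is 1 for y >= exp (- a) and 0 for y <= exp (- a) - 1 /
      k. As exp (- x) decreases in x, composing with it approximates the indicator of the closed
      half-line up to \<open>a\<close>.\<close>
    define f where "f k y = max 0 (min 1 (1 + real k * (y - exp (- a))))" for k :: nat and y :: real
    have fc: "continuous_on UNIV (f k)" for k
      unfolding f_def by (intro continuous_intros)
    have fm: "f k \<in> borel_measurable borel" for k
      by (rule borel_measurable_continuous_onI[OF fc])
    note [measurable] = fm
    have lim: "(\<lambda>k. f k (exp (- x))) \<longlonglongrightarrow> indicator {..a} x" for x
    proof (cases "x \<le> a")
      case True
      then have "f k (exp (- x)) = 1" for k
        unfolding f_def by (auto simp: min_def)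
      then show ?thesis using True by simp
    next
      case False
      define d where "d = exp (- a) - exp (- x)"
      have "d > 0" using False by (simp add: d_def)
      obtain K :: nat where K: "1 / d < real K" using reals_Archimedean2 by blast
      have "f k (exp (- x)) = 0" if "k \<ge> K" for k
      proof -
        have "1 / d \<le> real k" using K that by linarith
        then have "1 \<le> real k * d" using \<open>d > 0\<close> by (simp add: field_simps)
        then show ?thesis by (simp add: f_def d_def algebra_simps)
      qed
      then have "eventually (\<lambda>k. f k (exp (- x)) = indicator {..a} x) sequentially"
        using False by (auto simp: eventually_sequentially)
      then show ?thesis by (rule tendsto_eventually)
    qed
    have "(\<lambda>k. \<integral>x. f k (exp (- x)) \<partial>M) \<longlonglongrightarrow> (\<integral>x. (indicator {..a} x :: real) \<partial>M)"
      by (rule integral_dominated_convergence[where w="\<lambda>_. 1"]) (use lim in \<open>auto simp: f_def\<close>)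
    moreover have "(\<lambda>k. \<integral>x. f k (exp (- x)) \<partial>N) \<longlonglongrightarrow> (\<integral>x. (indicator {..a} x :: real) \<partial>N)"
      by (rule integral_dominated_convergence[where w="\<lambda>_. 1"]) (use lim in \<open>auto simp: f_def\<close>)
    moreover have "(\<integral>x. f k (exp (- x)) \<partial>M) = (\<integral>x. f k (exp (- x)) \<partial>N)" for k
      using cont[OF fc[of k]] by blast
    ultimately have "(\<integral>x. (indicator {..a} x :: real) \<partial>M) = (\<integral>x. (indicator {..a} x :: real) \<partial>N)"
      by (simp only: LIMSEQ_unique)
    then show ?thesis by (simp add: spM)
  qed
  then have "cdf M = cdf N" by (simp add: cdf_def fun_eq_iff)
  moreover have "finite_borel_measure M" "finite_borel_measure N"
    by (auto intro!: finite_borel_measure.intro M.finite_measure_axioms N.finite_measure_axioms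
        simp: finite_borel_measure_axioms_def M N)
  ultimately show ?thesis by (intro cdf_unique')
qed

section \<open>Gaussian integrals with the weight exp (- s x^2)\<close>

lemma normal_density_tilt:
  fixes m s x :: real
  assumes "0 \<le> s"
  shows "normal_density m 1 x * exp (- (s * x\<^sup>2)) =
    exp (- (s * m\<^sup>2 / (1 + 2 * s))) / sqrt (1 + 2 * s) *
    normal_density (m / (1 + 2 * s)) (1 / sqrt (1 + 2 * s)) x"
proof -
  define a where "a = 1 + 2 * s"
  have a: "a > 0" "s = (a - 1) / 2" using assms by (auto simp: a_def)
  \<comment> \<open>Completing the square: the coefficient of x^2 is - a / 2, hence variance 1 / a
    and mean m / a, and the terms free of x leave - s m^2 / a.\<close>
  have e: "- (x - m)\<^sup>2 / 2 + - (s * x\<^sup>2) = - (s * m\<^sup>2 / a) + - (x - m / a)\<^sup>2 / (2 * (1 / sqrt a)\<^sup>2)"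
    using a(1) unfolding a(2) by (simp add: power_divide field_simps power2_eq_square)
  have "normal_density m 1 x * exp (- (s * x\<^sup>2)) = 1 / sqrt (2 * pi) * exp (- (x - m)\<^sup>2 / 2 + - (s * x\<^sup>2))"
    by (simp add: normal_density_def exp_add[symmetric])
  also have "\<dots> = exp (- (s * m\<^sup>2 / a)) / sqrt a * (1 / sqrt (2 * pi / a) * exp (- (x - m / a)\<^sup>2 / (2 * (1 / sqrt a)\<^sup>2)))"
    unfolding e exp_add using a by (simp add: real_sqrt_divide real_sqrt_mult)
  also have "\<dots> = exp (- (s * m\<^sup>2 / a)) / sqrt a * normal_density (m / a) (1 / sqrt a) x"
    using a(1) by (simp add: normal_density_def power_divide)
  finally show ?thesis by (simp add: a_def)
qed

lemma has_bochner_integral_normal_square: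
  assumes "0 < \<sigma>"
  shows "has_bochner_integral lborel (\<lambda>x. normal_density \<mu> \<sigma> x * x\<^sup>2) (\<sigma>\<^sup>2 + \<mu>\<^sup>2)"
proof -
  \<comment> \<open>Here x^2 is split as (x - \<mu>)^2 + 2 \<mu> x - \<mu>^2, so the variance, the
    mean and the total mass suffice.\<close>
  have "has_bochner_integral lborel (\<lambda>x. normal_density \<mu> \<sigma> x * (x - \<mu>)\<^sup>2 + 2 * \<mu> * (normal_density \<mu> \<sigma> x * x)
      - \<mu>\<^sup>2 * normal_density \<mu> \<sigma> x) (\<sigma>\<^sup>2 + 2 * \<mu> * \<mu> - \<mu>\<^sup>2 * 1)"
  proof (intro has_bochner_integral_add has_bochner_integral_diff has_bochner_integral_mult_right)
    show "has_bochner_integral lborel (\<lambda>x. normal_density \<mu> \<sigma> x * (x - \<mu>)\<^sup>2) (\<sigma>\<^sup>2)"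
      using normal_moment_even[OF assms, of \<mu> 1] by (simp add: fact_numeral)
    show "has_bochner_integral lborel (\<lambda>x. normal_density \<mu> \<sigma> x * x) \<mu>"
      by (rule normal_moment_nz_1[OF assms])
    show "has_bochner_integral lborel (normal_density \<mu> \<sigma>) 1"
      using assms by (simp add: has_bochner_integral_iff)
  qed
  then show ?thesis
    by (simp add: power2_eq_square algebra_simps)
qed

text \<open>By \<open>normal_density_tilt\<close> both integrals are a constant times a moment of
  another normal law: its total mass, respectively its second moment as variance plus squared
  mean.\<close>

lemma nn_integral_normal_exp_square:
  assumes "0 \<le> s"
  shows "(\<integral>\<^sup>+x. ennreal (exp (- (s * x\<^sup>2))) \<partial>density lborel (normal_density m 1)) =
      ennreal (exp (- (s * m\<^sup>2 / (1 + 2 * s))) / sqrt (1 + 2 * s))"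
    and "(\<integral>\<^sup>+x. ennreal (exp (- (s * x\<^sup>2))) * ennreal (x\<^sup>2) \<partial>density lborel (normal_density m 1)) =
      ennreal (exp (- (s * m\<^sup>2 / (1 + 2 * s))) / sqrt (1 + 2 * s)) *
      ennreal (1 / (1 + 2 * s) + m\<^sup>2 / (1 + 2 * s)\<^sup>2)"
proof -
  define c where "c = exp (- (s * m\<^sup>2 / (1 + 2 * s))) / sqrt (1 + 2 * s)"
  define \<sigma> where "\<sigma> = 1 / sqrt (1 + 2 * s)"
  define n where "n = m / (1 + 2 * s)"
  have pos: "0 < \<sigma>" "0 \<le> c" using assms by (auto simp: c_def \<sigma>_def)
  have tilt: "normal_density m 1 x * exp (- (s * x\<^sup>2)) = c * normal_density n \<sigma> x" for x
    unfolding c_def \<sigma>_def n_def by (rule normal_density_tilt[OF assms])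
  have "(\<integral>\<^sup>+x. ennreal (exp (- (s * x\<^sup>2))) \<partial>density lborel (normal_density m 1))
      = (\<integral>\<^sup>+x. ennreal (c * normal_density n \<sigma> x) \<partial>lborel)"
    by (simp add: nn_integral_density ennreal_mult[symmetric] tilt)
  also have "\<dots> = ennreal (c * 1)"
    using pos by (intro nn_integral_eq_integral[THEN trans]) auto
  finally show "(\<integral>\<^sup>+x. ennreal (exp (- (s * x\<^sup>2))) \<partial>density lborel (normal_density m 1)) =
      ennreal (exp (- (s * m\<^sup>2 / (1 + 2 * s))) / sqrt (1 + 2 * s))" by (simp add: c_def)
  have "(\<integral>\<^sup>+x. ennreal (exp (- (s * x\<^sup>2))) * ennreal (x\<^sup>2) \<partial>density lborel (normal_density m 1))
      = (\<integral>\<^sup>+x. ennreal (c * (normal_density n \<sigma> x * x\<^sup>2)) \<partial>lborel)"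
    by (simp add: nn_integral_density ennreal_mult[symmetric] tilt mult.assoc[symmetric])
  also have "\<dots> = ennreal (c * (\<sigma>\<^sup>2 + n\<^sup>2))"
    using pos has_bochner_integral_normal_square[OF pos(1), of n]
    by (intro nn_integral_eq_integral[THEN trans]) (auto simp: has_bochner_integral_iff)
  also have "\<sigma>\<^sup>2 + n\<^sup>2 = 1 / (1 + 2 * s) + m\<^sup>2 / (1 + 2 * s)\<^sup>2"
    using assms by (simp add: \<sigma>_def n_def power_divide)
  finally show "(\<integral>\<^sup>+x. ennreal (exp (- (s * x\<^sup>2))) * ennreal (x\<^sup>2) \<partial>density lborel (normal_density m 1)) =
      ennreal (exp (- (s * m\<^sup>2 / (1 + 2 * s))) / sqrt (1 + 2 * s)) *
      ennreal (1 / (1 + 2 * s) + m\<^sup>2 / (1 + 2 * s)\<^sup>2)"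
    using pos assms unfolding c_def[symmetric] by (subst ennreal_mult[symmetric]) auto
qed

lemma nn_integral_normal_id_prod:
  assumes "finite J" "\<And>i. i \<in> J \<Longrightarrow> f i \<in> borel_measurable borel"
  shows "(\<integral>\<^sup>+z. (\<Prod>i\<in>J. f i (z i)) \<partial>normal_id J m) =
    (\<Prod>i\<in>J. \<integral>\<^sup>+x. f i x \<partial>density lborel (normal_density (m i) 1))"
proof -
  interpret product_sigma_finite "\<lambda>i. density lborel (normal_density (m i) 1)"
    by (simp add: product_sigma_finite_def prob_space_imp_sigma_finite prob_space_normal_density)
  show ?thesis
    unfolding normal_id_def using assms by (intro product_nn_integral_prod) auto
qed

text \<open>Independence factors the integral over the coordinates, and those in J - I contribute 1.
  For the theorem \<open>J\<close> is the full coordinate set and \<open>I\<close> the part seen by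
  the quadratic forms; for the chi-square law I = J.\<close>

lemma nn_integral_normal_id_exp_squares:
  fixes m :: "'i \<Rightarrow> real"
  assumes J: "finite J" "I \<subseteq> J" and s: "0 \<le> s"
  defines "c \<equiv> exp (- (s * (\<Sum>i\<in>I. (m i)\<^sup>2) / (1 + 2 * s))) / sqrt (1 + 2 * s) ^ card I"
  shows "(\<integral>\<^sup>+z. ennreal (exp (- (s * (\<Sum>i\<in>I. (z i)\<^sup>2)))) \<partial>normal_id J m) = ennreal c"
    and "j \<in> I \<Longrightarrow> (\<integral>\<^sup>+z. ennreal (exp (- (s * (\<Sum>i\<in>I. (z i)\<^sup>2)))) * ennreal ((z j)\<^sup>2) \<partial>normal_id J m) =
      ennreal c * ennreal (1 / (1 + 2 * s) + (m j)\<^sup>2 / (1 + 2 * s)\<^sup>2)"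
proof -
  define g where "g i x = (if i \<in> I then ennreal (exp (- (s * x\<^sup>2))) else 1)" for i and x :: real
  have finI: "finite I" using J finite_subset by blast
  have [measurable]: "g i \<in> borel_measurable borel" for i
    unfolding g_def by measurable
  have prod_I: "(\<Prod>i\<in>J. if i \<in> I then h i else 1) = (\<Prod>i\<in>I. h i)" for h :: "'i \<Rightarrow> ennreal"
    using J by (simp add: prod.inter_restrict[symmetric] Int_absorb1)
  have exp_prod: "ennreal (exp (- (s * (\<Sum>i\<in>I. (z i)\<^sup>2)))) = (\<Prod>i\<in>J. g i (z i))" for z
    using finI by (simp add: g_def prod_I prod_ennreal exp_sum[symmetric] sum_distrib_left sum_negf)
  define b where "b i = exp (- (s * (m i)\<^sup>2 / (1 + 2 * s))) / sqrt (1 + 2 * s)" for i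
  have b: "b i \<ge> 0" for i using s by (simp add: b_def)
  have prod_b: "(\<Prod>i\<in>I. ennreal (b i)) = ennreal c"
    using b finI by (simp add: prod_ennreal b_def c_def prod_dividef exp_sum[symmetric] sum_negf
        sum_distrib_left sum_divide_distrib)
  have int_g: "(\<integral>\<^sup>+x. g i x \<partial>density lborel (normal_density (m i) 1)) = (if i \<in> I then ennreal (b i) else 1)" for i
    using nn_integral_normal_exp_square(1)[OF s, of "m i"]
      prob_space.emeasure_space_1[OF prob_space_normal_density[of 1 "m i"]]
    by (auto simp: g_def b_def)
  show "(\<integral>\<^sup>+z. ennreal (exp (- (s * (\<Sum>i\<in>I. (z i)\<^sup>2)))) \<partial>normal_id J m) = ennreal c"
    using J(1) by (simp add: exp_prod nn_integral_normal_id_prod int_g prod_I prod_b)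
  assume j: "j \<in> I"
  \<comment> \<open>Places the extra square in the factor of \<open>j\<close> alone, so only that
    factor turns into a second moment.\<close>
  define q where "q i x = (if i = j then ennreal (x\<^sup>2) else 1)" for i and x :: real
  have [measurable]: "q i \<in> borel_measurable borel" for i
    unfolding q_def by measurable
  have "ennreal (exp (- (s * (\<Sum>i\<in>I. (z i)\<^sup>2)))) * ennreal ((z j)\<^sup>2) = (\<Prod>i\<in>J. g i (z i) * q i (z i))" for z
    using J j by (auto simp: exp_prod prod.distrib q_def)
  then have "(\<integral>\<^sup>+z. ennreal (exp (- (s * (\<Sum>i\<in>I. (z i)\<^sup>2)))) * ennreal ((z j)\<^sup>2) \<partial>normal_id J m)
    = (\<Prod>i\<in>J. \<integral>\<^sup>+x. g i x * q i x \<partial>density lborel (normal_density (m i) 1))"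
    using J(1) nn_integral_normal_id_prod[of J "\<lambda>i x. g i x * q i x" m] by simp
  also have "\<dots> = (\<Prod>i\<in>J. (if i \<in> I then ennreal (b i) else 1) *
      (if i = j then ennreal (1 / (1 + 2 * s) + (m j)\<^sup>2 / (1 + 2 * s)\<^sup>2) else 1))"
    using j int_g nn_integral_normal_exp_square(2)[OF s, of "m j"]
    by (intro prod.cong) (auto simp: q_def g_def b_def)
  also have "\<dots> = ennreal c * ennreal (1 / (1 + 2 * s) + (m j)\<^sup>2 / (1 + 2 * s)\<^sup>2)"
    using J j by (auto simp: prod.distrib prod_I prod_b)
  finally show "(\<integral>\<^sup>+z. ennreal (exp (- (s * (\<Sum>i\<in>I. (z i)\<^sup>2)))) * ennreal ((z j)\<^sup>2) \<partial>normal_id J m) =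
      ennreal c * ennreal (1 / (1 + 2 * s) + (m j)\<^sup>2 / (1 + 2 * s)\<^sup>2)" .
qed

text \<open>Supplies P + r Q as a single measure, to which \<open>laplace_transform_unique\<close>
  can be applied. It is the image of a weighted boolean times the product of \<open>P\<close> and
  \<open>Q\<close> under selection of a coordinate: \<open>True\<close> has mass 1,
  \<open>False\<close> has mass r, and the coordinate not selected integrates out because its law is
  a probability.\<close>

lemma ex_measure_add_scaled:
  fixes P Q :: "real measure" and r :: real
  assumes P: "prob_space P" "sets P = sets borel" and Q: "prob_space Q" "sets Q = sets borel"
    and r: "0 \<le> r"
  obtains S where "sets S = sets borel"
    and "\<And>g. g \<in> borel_measurable borel \<Longrightarrow> (\<integral>\<^sup>+x. g x \<partial>S) = (\<integral>\<^sup>+x. g x \<partial>P) + ennreal r * (\<integral>\<^sup>+x. g x \<partial>Q)"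
proof -
  interpret P: prob_space P by fact
  interpret Q: prob_space Q by fact
  interpret PQ: pair_prob_space P Q ..
  note [measurable_cong] = P(2) Q(2)
  define w :: "bool \<Rightarrow> ennreal" where "w b = (if b then 1 else ennreal r)" for b
  define K where "K = density (count_space UNIV) w"
  define f :: "bool \<times> real \<times> real \<Rightarrow> real" where "f = (\<lambda>(b, x, y). if b then x else y)"
  have [measurable]: "w \<in> borel_measurable (count_space UNIV)" by simp
  have [measurable_cong]: "sets K = sets (count_space UNIV)" by (simp add: K_def)
  have f[measurable]: "f \<in> borel_measurable (K \<Otimes>\<^sub>M (P \<Otimes>\<^sub>M Q))"
    unfolding f_def by measurable
  define S where "S = distr (K \<Otimes>\<^sub>M (P \<Otimes>\<^sub>M Q)) borel f"
  have "(\<integral>\<^sup>+x. g x \<partial>S) = (\<integral>\<^sup>+x. g x \<partial>P) + ennreal r * (\<integral>\<^sup>+x. g x \<partial>Q)"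
    if g[measurable]: "g \<in> borel_measurable borel" for g
  proof -
    have 1: "(\<integral>\<^sup>+z. g (fst z) \<partial>(P \<Otimes>\<^sub>M Q)) = (\<integral>\<^sup>+x. g x \<partial>P)"
      by (subst Q.nn_integral_fst[symmetric]) (auto simp: Q.emeasure_space_1)
    have 2: "(\<integral>\<^sup>+z. g (snd z) \<partial>(P \<Otimes>\<^sub>M Q)) = (\<integral>\<^sup>+x. g x \<partial>Q)"
      by (subst Q.nn_integral_fst[symmetric]) (auto simp: P.emeasure_space_1)
    have "(\<integral>\<^sup>+x. g x \<partial>S) = (\<integral>\<^sup>+z. g (f z) \<partial>(K \<Otimes>\<^sub>M (P \<Otimes>\<^sub>M Q)))"
      unfolding S_def by (rule nn_integral_distr) auto
    also have "\<dots> = (\<integral>\<^sup>+b. \<integral>\<^sup>+z. g (f (b, z)) \<partial>(P \<Otimes>\<^sub>M Q) \<partial>K)"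
      by (rule PQ.nn_integral_fst[symmetric]) simp
    also have "\<dots> = (\<integral>\<^sup>+b. w b * (\<integral>\<^sup>+z. g (f (b, z)) \<partial>(P \<Otimes>\<^sub>M Q)) \<partial>count_space UNIV)"
      unfolding K_def by (rule nn_integral_density) auto
    also have "\<dots> = (\<integral>\<^sup>+z. g (fst z) \<partial>(P \<Otimes>\<^sub>M Q)) + ennreal r * (\<integral>\<^sup>+z. g (snd z) \<partial>(P \<Otimes>\<^sub>M Q))"
      by (simp add: nn_integral_count_space_finite UNIV_bool w_def f_def case_prod_beta add.commute)
    finally show ?thesis by (simp only: 1 2)
  qed
  moreover have "sets S = sets borel" by (simp add: S_def)
  ultimately show ?thesis using that by blast
qed

text \<open>The assumption \<open>nn\<close> speaks of nonnegative functions; applied to the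
  positive and negative parts of \<open>h\<close>, whose integrals are finite, it yields the signed
  integral.\<close>

lemma has_bochner_integral_add_scaled_measure:
  fixes h :: "real \<Rightarrow> real"
  assumes S: "sets S = sets borel"
    and nn: "\<And>g. g \<in> borel_measurable borel \<Longrightarrow> (\<integral>\<^sup>+x. g x \<partial>S) = (\<integral>\<^sup>+x. g x \<partial>P) + ennreal r * (\<integral>\<^sup>+x. g x \<partial>Q)"
    and r: "0 \<le> r" and h[measurable]: "h \<in> borel_measurable borel" and int: "integrable P h" "integrable Q h"
  shows "has_bochner_integral S h ((\<integral>x. h x \<partial>P) + r * (\<integral>x. h x \<partial>Q))"
proof -
  note [measurable_cong] = S
  have fin: "(\<integral>\<^sup>+x. ennreal (h x) \<partial>P) < \<infinity>" "(\<integral>\<^sup>+x. ennreal (- h x) \<partial>P) < \<infinity>"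
    "(\<integral>\<^sup>+x. ennreal (h x) \<partial>Q) < \<infinity>" "(\<integral>\<^sup>+x. ennreal (- h x) \<partial>Q) < \<infinity>"
    using int unfolding real_integrable_def by (auto simp: less_top)
  have "(\<integral>\<^sup>+x. ennreal (h x) \<partial>S) < \<infinity>" "(\<integral>\<^sup>+x. ennreal (- h x) \<partial>S) < \<infinity>"
    using fin by (auto simp: nn ennreal_mult_less_top)
  then have "integrable S h"
    unfolding real_integrable_def by auto
  moreover have "(\<integral>x. h x \<partial>S) = (\<integral>x. h x \<partial>P) + r * (\<integral>x. h x \<partial>Q)"
    using fin r unfolding real_lebesgue_integral_def[OF \<open>integrable S h\<close>]
      real_lebesgue_integral_def[OF int(1)] real_lebesgue_integral_def[OF int(2)]
    by (simp add: nn enn2real_plus ennreal_mult_less_top enn2real_mult algebra_simps)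
  ultimately show ?thesis by (simp add: has_bochner_integral_iff)
qed

section \<open>Noncentral chi-square laws\<close>

lemma noncentral_chi_square_props:
  assumes "noncentral_chi_square \<nu> \<Delta> Q"
  shows sets_noncentral_chi_square: "sets Q = sets borel"
    and AE_noncentral_chi_square: "AE x in Q. 0 \<le> x"
    and laplace_noncentral_chi_square: "0 \<le> s \<Longrightarrow> (\<integral>\<^sup>+x. ennreal (exp (- (s * x))) \<partial>Q) =
      ennreal (exp (- (s * \<Delta> / (1 + 2 * s))) / sqrt (1 + 2 * s) ^ \<nu>)"
proof -
  obtain \<theta> where \<theta>: "(\<Sum>i<\<nu>. (\<theta> i)\<^sup>2) = \<Delta>"
    and Q: "Q = distr (normal_id {..<\<nu>} \<theta>) borel (\<lambda>z. \<Sum>i<\<nu>. (z i)\<^sup>2)"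
    using assms unfolding noncentral_chi_square_def by blast
  note [measurable] = measurable_sum_squares[of \<nu> \<theta>]
  show "sets Q = sets borel" by (simp add: Q)
  show "AE x in Q. 0 \<le> x"
    unfolding Q by (subst AE_distr_iff) (auto intro!: AE_I2 sum_nonneg)
  show "(\<integral>\<^sup>+x. ennreal (exp (- (s * x))) \<partial>Q) =
      ennreal (exp (- (s * \<Delta> / (1 + 2 * s))) / sqrt (1 + 2 * s) ^ \<nu>)" if "0 \<le> s"
    \<comment> \<open>The mean vector enters the transform only through its sum of squares, so every
      admissible \<theta> gives the same value.\<close>
    unfolding Q using nn_integral_normal_id_exp_squares(1)[of "{..<\<nu>}" "{..<\<nu>}" s \<theta>] that \<theta>
    by (subst nn_integral_distr) auto
qed

text \<open>Weighting the normal law by (z j)^2 and pushing it forward by the sum of squares over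
  \<open>I\<close> gives a measure with the Laplace transform of Q2 + (m j)^2 Q4. The two measures
  therefore agree, and integrability on the normal side is inherited from \<open>Q2\<close> and
  \<open>Q4\<close>.\<close>

lemma has_bochner_integral_normal_id_square:
  fixes h :: "real \<Rightarrow> real" and m :: "'i \<Rightarrow> real"
  assumes J: "finite J" "I \<subseteq> J" and j: "j \<in> I"
    and Q2: "noncentral_chi_square (card I + 2) (\<Sum>i\<in>I. (m i)\<^sup>2) Q2"
    and Q4: "noncentral_chi_square (card I + 4) (\<Sum>i\<in>I. (m i)\<^sup>2) Q4"
    and h[measurable]: "h \<in> borel_measurable borel" and int: "integrable Q2 h" "integrable Q4 h"
  shows "has_bochner_integral (normal_id J m) (\<lambda>z. h (\<Sum>i\<in>I. (z i)\<^sup>2) * (z j)\<^sup>2)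
    ((\<integral>y. h y \<partial>Q2) + (m j)\<^sup>2 * (\<integral>y. h y \<partial>Q4))"
proof -
  obtain S where S: "sets S = sets borel" and
    nn: "\<And>g. g \<in> borel_measurable borel \<Longrightarrow> (\<integral>\<^sup>+x. g x \<partial>S) = (\<integral>\<^sup>+x. g x \<partial>Q2) + ennreal ((m j)\<^sup>2) * (\<integral>\<^sup>+x. g x \<partial>Q4)"
    using ex_measure_add_scaled[of Q2 Q4 "(m j)\<^sup>2"] Q2 Q4
    by (auto simp: prob_space_noncentral_chi_square sets_noncentral_chi_square)
  have coord[measurable]: "(\<lambda>z. z i) \<in> borel_measurable (normal_id J m)" if "i \<in> J" for i
    using measurable_component_singleton[OF that, of "\<lambda>_. borel"]
      measurable_cong_sets[OF sets_normal_id[of J m] refl] by blast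
  have [measurable]: "(\<lambda>z. z j) \<in> borel_measurable (normal_id J m)"
    using j J by (intro coord) auto
  have sq[measurable]: "(\<lambda>z. \<Sum>i\<in>I. (z i)\<^sup>2) \<in> borel_measurable (normal_id J m)"
    using J by (intro borel_measurable_sum borel_measurable_power coord) auto
  define N where "N = distr (density (normal_id J m) (\<lambda>z. ennreal ((z j)\<^sup>2))) borel (\<lambda>z. \<Sum>i\<in>I. (z i)\<^sup>2)"
  have nnN: "(\<integral>\<^sup>+x. g x \<partial>N) = (\<integral>\<^sup>+z. g (\<Sum>i\<in>I. (z i)\<^sup>2) * ennreal ((z j)\<^sup>2) \<partial>normal_id J m)"
    if [measurable]: "g \<in> borel_measurable borel" for g
    unfolding N_def by (simp add: nn_integral_distr nn_integral_density mult.commute)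
  define L where "L s = exp (- (s * (\<Sum>i\<in>I. (m i)\<^sup>2) / (1 + 2 * s))) / sqrt (1 + 2 * s) ^ card I" for s
  have lapN: "(\<integral>\<^sup>+x. ennreal (exp (- (s * x))) \<partial>N) = ennreal (L s * (1 / (1 + 2 * s) + (m j)\<^sup>2 / (1 + 2 * s)\<^sup>2))"
    if "0 \<le> s" for s
    unfolding L_def using that nn_integral_normal_id_exp_squares(2)[OF J that j, of m]
    by (subst ennreal_mult) (auto simp: nnN)
  have lapS: "(\<integral>\<^sup>+x. ennreal (exp (- (s * x))) \<partial>S) = ennreal (L s * (1 / (1 + 2 * s) + (m j)\<^sup>2 / (1 + 2 * s)\<^sup>2))"
    if s: "0 \<le> s" for s
  proof -
    define a where "a = 1 + 2 * s"
    have a: "a > 0" using s by (simp add: a_def)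
    \<comment> \<open>Degrees of freedom appear as inverse powers of sqrt a: two extra ones give 1 /
      a and four give 1 / a^2, while the factor \<open>L s\<close> is common.\<close>
    have "sqrt a ^ 4 = a\<^sup>2"
      using a by (simp add: power4_eq_xxxx power2_eq_square)
    then have "L s / sqrt a ^ 2 + (m j)\<^sup>2 * (L s / sqrt a ^ 4) = L s * (1 / a + (m j)\<^sup>2 / a\<^sup>2)"
      using a by (simp add: field_simps)
    moreover have "L s \<ge> 0" using a by (simp add: L_def flip: a_def)
    moreover have "(\<integral>\<^sup>+x. ennreal (exp (- (s * x))) \<partial>Q2) = ennreal (L s / sqrt a ^ 2)"
      "(\<integral>\<^sup>+x. ennreal (exp (- (s * x))) \<partial>Q4) = ennreal (L s / sqrt a ^ 4)"
      using laplace_noncentral_chi_square[OF Q2 s] laplace_noncentral_chi_square[OF Q4 s]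
      by (simp_all only: L_def power_add a_def divide_divide_eq_left)
    ultimately show ?thesis
      using a unfolding a_def[symmetric]
      by (simp add: nn ennreal_mult[symmetric] ennreal_plus[symmetric] del: ennreal_plus real_sqrt_pow2)
  qed
  have "N = S"
  proof (rule laplace_transform_unique)
    show "sets N = sets borel" by (simp add: N_def)
    \<comment> \<open>The transform at s = 0 is the total mass.\<close>
    show "emeasure N UNIV < \<infinity>"
      using lapN[of 0] by (simp add: N_def)
    show "AE x in N. 0 \<le> x"
      unfolding N_def by (subst AE_distr_iff) (auto intro!: AE_I2 sum_nonneg)
    \<comment> \<open>\<open>S\<close> is known only through its integrals, so its support is
      controlled by integrating the indicator of the negative half-line.\<close>
    have null: "emeasure Q {..<0} = 0" if "noncentral_chi_square n d Q" for Q n d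
    proof -
      have "AE x in Q. x \<notin> {..<0}"
        using AE_noncentral_chi_square[OF that] by eventually_elim auto
      then show ?thesis
        by (subst (asm) AE_iff_measurable[OF _ refl]) (auto simp: sets_noncentral_chi_square[OF that] sets_eq_imp_space_eq[OF sets_noncentral_chi_square[OF that]] lessThan_def)
    qed
    have "emeasure S {..<0} = 0"
      using nn[of "indicator {..<0}"] null[OF Q2] null[OF Q4]
      by (simp add: S sets_noncentral_chi_square[OF Q2] sets_noncentral_chi_square[OF Q4])
    then have "AE x in S. x \<notin> {..<0}"
      by (intro AE_not_in null_setsI) (auto simp: S)
    then show "AE x in S. 0 \<le> x"
      by eventually_elim auto
  qed (auto simp: S lapN lapS)
  then have "has_bochner_integral N h ((\<integral>y. h y \<partial>Q2) + (m j)\<^sup>2 * (\<integral>y. h y \<partial>Q4))"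
    using has_bochner_integral_add_scaled_measure[OF S nn _ h int] by simp
  then show ?thesis
    unfolding N_def has_bochner_integral_iff
    by (simp add: integrable_distr_eq integral_distr integrable_density integral_density mult.commute)
qed

section \<open>Quadratic forms in normal vectors\<close>

theorem theoremC2:
  fixes h :: "real \<Rightarrow> real"
    and M :: "'a measure"
    and X :: "'a \<Rightarrow> real^'p"
    and \<mu> :: "real^'p"
    and \<Sigma> A W Wstar :: "real^'p^'p"
    and k :: nat
    and D1 D2 :: real
    and Q2 Q4 :: "real measure"
  assumes "prob_space M"
    and "nonneg_definite \<Sigma>" and "rank \<Sigma> = k"
    and "X \<in> borel_measurable M" and "distr M borel X = mvnormal \<mu> \<Sigma>"
    and "nonneg_definite A" and "rank A = k"
    and "(\<Sigma> ** A) ** (\<Sigma> ** A) = \<Sigma> ** A"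
    and "A ** \<Sigma> ** A = A"
    and "\<Sigma> ** A ** \<Sigma> = \<Sigma>"
    and "(\<Sigma> ** A) *v \<mu> = \<mu>"
    and "nonneg_definite Wstar"
    and "W = nnd_sqrt A ** Wstar ** nnd_sqrt A"
    and "D1 = trace (W ** \<Sigma>)"
    and "D2 = \<mu> \<bullet> (W *v \<mu>)"
    and "noncentral_chi_square (k + 2) (\<mu> \<bullet> (A *v \<mu>)) Q2"
    and "noncentral_chi_square (k + 4) (\<mu> \<bullet> (A *v \<mu>)) Q4"
    and "h \<in> borel_measurable borel"
    and "integrable M (\<lambda>\<omega>. h (X \<omega> \<bullet> (A *v X \<omega>)) * (X \<omega> \<bullet> (W *v X \<omega>)))"
    and "integrable Q2 h"
    and "integrable Q4 h"
  shows "(\<integral>\<omega>. h (X \<omega> \<bullet> (A *v X \<omega>)) * (X \<omega> \<bullet> (W *v X \<omega>)) \<partial>M) =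
           (\<integral>y. h y \<partial>Q2) * D1 + (\<integral>y. h y \<partial>Q4) * D2"
proof -
  define B where "B = nnd_sqrt \<Sigma>"
  have nndB: "nonneg_definite B" and BB: "B ** B = \<Sigma>"
    using nnd_sqrt[OF \<open>nonneg_definite \<Sigma>\<close>] by (auto simp: B_def)
  have symB: "transpose B = B" using nndB by (simp add: nonneg_definite_def)
  have symA: "transpose A = A" using \<open>nonneg_definite A\<close> by (simp add: nonneg_definite_def)
  have sym\<Sigma>: "transpose \<Sigma> = \<Sigma>" using \<open>nonneg_definite \<Sigma>\<close> by (simp add: nonneg_definite_def)
  have nnd_conj: "nonneg_definite (S ** T ** S)"
    if "nonneg_definite S" "nonneg_definite T" for S T :: "real^'p^'p"
  proof -
    have "x \<bullet> (S ** T ** S *v x) = (S *v x) \<bullet> (T *v (S *v x))" for x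
      using that(1) symmetric_inner_mult[of S x "T *v (S *v x)"]
      by (simp add: nonneg_definite_def matrix_vector_mul_assoc matrix_mul_assoc)
    then show ?thesis
      using that by (simp add: nonneg_definite_def matrix_transpose_mul matrix_mul_assoc)
  qed
  have conj_B: "x \<bullet> (B ** T ** B *v x) = (B *v x) \<bullet> (T *v (B *v x))" for x T
    using symmetric_inner_mult[OF symB, of x "T *v (B *v x)"]
    by (simp add: matrix_vector_mul_assoc matrix_mul_assoc)
  \<comment> \<open>B and \<Sigma> have the same kernel because |B y|^2 = y . \<Sigma> y, and A
    \<Sigma> x - x lies in it.\<close>
  have BA\<Sigma>: "B ** A ** \<Sigma> = B"
  proof -
    have "B *v ((A ** \<Sigma>) *v x) = B *v x" for x
    proof -
      define y where "y = (A ** \<Sigma>) *v x - x"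
      have "\<Sigma> *v y = 0"
        using \<open>\<Sigma> ** A ** \<Sigma> = \<Sigma>\<close> by (simp add: y_def matrix_vector_mult_diff_distrib matrix_vector_mul_assoc matrix_mul_assoc)
      moreover have "(B *v y) \<bullet> (B *v y) = y \<bullet> (\<Sigma> *v y)"
        using symmetric_inner_mult[OF symB, of y "B *v y"] by (simp add: matrix_vector_mul_assoc BB)
      ultimately have "B *v y = 0" by simp
      then show ?thesis by (simp add: y_def matrix_vector_mult_diff_distrib)
    qed
    then show ?thesis by (simp add: matrix_eq matrix_vector_mul_assoc matrix_mul_assoc)
  qed
  have \<Sigma>AB: "\<Sigma> ** A ** B = B"
    using arg_cong[OF BA\<Sigma>, of transpose] by (simp add: matrix_transpose_mul symA symB sym\<Sigma> matrix_mul_assoc)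
  define Q where "Q = B ** A ** B"
  define V where "V = B ** W ** B"
  \<comment> \<open>A preimage of the mean under B, by \<Sigma> A \<mu> = \<mu>.\<close>
  define \<theta> where "\<theta> = B *v (A *v \<mu>)"
  have B\<theta>: "B *v \<theta> = \<mu>"
    using \<open>(\<Sigma> ** A) *v \<mu> = \<mu>\<close> by (simp add: \<theta>_def matrix_vector_mul_assoc BB matrix_mul_assoc)
  have "nonneg_definite W"
    using \<open>W = _\<close> nnd_conj nonneg_definite_nnd_sqrt[OF \<open>nonneg_definite A\<close>] \<open>nonneg_definite Wstar\<close> by simp
  then have nndQV: "nonneg_definite Q" "nonneg_definite V"
    using nnd_conj[OF nndB] \<open>nonneg_definite A\<close> by (auto simp: Q_def V_def)
  have BQ: "B ** Q = B"
    using \<Sigma>AB by (simp add: Q_def matrix_mul_assoc BB)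
  have QB: "Q ** B = B"
    using BA\<Sigma> by (simp add: Q_def matrix_mul_assoc[symmetric] BB)
  have QQ: "Q ** Q = Q"
    using QB by (simp add: Q_def matrix_mul_assoc)
  have QV: "Q ** V = V"
    using QB by (simp add: V_def matrix_mul_assoc)
  have VQ: "V ** Q = V"
    using BQ by (simp add: V_def matrix_mul_assoc[symmetric])
  obtain r :: "'p \<Rightarrow> real^'p" and d :: "'p \<Rightarrow> real" and I :: "'p set"
    where r: "\<And>i j. r i \<bullet> r j = (if i = j then 1 else 0)"
      and Qx: "\<And>x. x \<bullet> (Q *v x) = (\<Sum>i\<in>I. (r i \<bullet> x)\<^sup>2)"
      and Vx: "\<And>x. x \<bullet> (V *v x) = (\<Sum>i\<in>I. d i * (r i \<bullet> x)\<^sup>2)"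
      and card_I: "card I = rank Q" and tr: "trace V = (\<Sum>i\<in>I. d i)"
    by (rule simultaneous_diagonalization[OF nndQV QQ QV VQ]) (rule that)
  \<comment> \<open>Q = BAB has rank at most that of A; conversely rank \<Sigma> = rank (BB) <= rank
    B = rank (BQ) <= rank Q.\<close>
  have "rank Q = k"
  proof (rule antisym)
    show "rank Q \<le> k"
      using rank_mul_le_left[of "B ** A" B] rank_mul_le_right[of B A] \<open>rank A = k\<close> by (simp add: Q_def)
    show "k \<le> rank Q"
      using rank_mul_le_left[of B B] rank_mul_le_right[of B Q] \<open>rank \<Sigma> = k\<close> by (simp add: BB BQ)
  qed
  define m where "m i = r i \<bullet> \<theta>" for i
  define c2 c4 where "c2 = (\<integral>y. h y \<partial>Q2)" and "c4 = (\<integral>y. h y \<partial>Q4)"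
  have \<Delta>: "\<mu> \<bullet> (A *v \<mu>) = (\<Sum>i\<in>I. (m i)\<^sup>2)"
    using Qx[of \<theta>] conj_B[of \<theta> A] by (simp add: Q_def B\<theta> m_def)
  have D2: "D2 = (\<Sum>i\<in>I. d i * (m i)\<^sup>2)"
    using Vx[of \<theta>] conj_B[of \<theta> W] \<open>D2 = _\<close> by (simp add: V_def B\<theta> m_def)
  \<comment> \<open>Cyclicity of the trace turns W B B into B W B = V.\<close>
  have D1: "D1 = (\<Sum>i\<in>I. d i)"
    using \<open>D1 = _\<close> trace_mul_sym[of "W ** B" B] tr by (simp add: V_def BB[symmetric] matrix_mul_assoc)
  define F where "F x = h (x \<bullet> (A *v x)) * (x \<bullet> (W *v x))" for x
  define g where "g z = (\<Sum>i\<in>UNIV. z i *\<^sub>R r i)" for z :: "'p \<Rightarrow> real"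
  have [measurable]: "(*v) T \<in> borel_measurable borel" for T :: "real^'p^'p"
    by (intro borel_measurable_continuous_onI matrix_vector_mult_linear_continuous_on)
  have [measurable]: "h \<in> borel_measurable borel" by fact
  have [measurable]: "F \<in> borel_measurable borel"
    unfolding F_def by measurable
  have [measurable]: "(\<lambda>z. z i) \<in> borel_measurable (normal_id UNIV m)" for i :: 'p
    using measurable_component_singleton[of i UNIV "\<lambda>_. borel"]
      measurable_cong_sets[OF sets_normal_id[of UNIV m] refl] by blast
  have [measurable]: "g \<in> borel_measurable (normal_id UNIV m)"
    unfolding g_def by measurable
  have [measurable_cong]: "sets (normal_vec \<theta>) = sets borel" for \<theta> :: "real^'p"
    by (simp add: normal_vec_def)
  \<comment> \<open>The mean is absorbed as a shift inside B; then the shifted vector is expressed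
    in the basis \<open>r\<close>, where its coordinates are independent with means
    \<open>m i\<close>.\<close>
  have "mvnormal \<mu> \<Sigma> = distr (normal_vec 0) borel (\<lambda>x. B *v (\<theta> + x))"
    by (simp add: mvnormal_eq_distr_normal_vec matrix_vector_right_distrib B\<theta> flip: B_def)
  also have "\<dots> = distr (distr (normal_vec 0) borel ((+) \<theta>)) borel ((*v) B)"
    by (subst distr_distr) (auto simp: comp_def)
  also have "\<dots> = distr (normal_vec \<theta>) borel ((*v) B)"
    by (simp add: distr_normal_vec_shift)
  also have "\<dots> = distr (distr (normal_id UNIV m) borel g) borel ((*v) B)"
    by (simp add: normal_vec_eq_distr_orthonormal_family[OF r] m_def[abs_def] g_def[abs_def])
  also have "\<dots> = distr (normal_id UNIV m) borel (\<lambda>z. B *v g z)"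
    by (subst distr_distr) (auto simp: comp_def)
  finally have law: "distr M borel X = distr (normal_id UNIV m) borel (\<lambda>z. B *v g z)"
    using \<open>distr M borel X = _\<close> by simp
  \<comment> \<open>The coordinates of \<open>g z\<close> in the basis \<open>r\<close> are the z i,
    so the argument of \<open>h\<close> is the sum of squares over \<open>I\<close>, and the other
    form splits the integrand by linearity.\<close>
  have F_g: "F (B *v g z) = (\<Sum>i\<in>I. d i * (h (\<Sum>i\<in>I. (z i)\<^sup>2) * (z i)\<^sup>2))" for z
  proof -
    have "r i \<bullet> g z = z i" for i
      by (simp add: g_def inner_sum_right r if_distrib[of "\<lambda>x. _ * x"] cong: if_cong)
    then show ?thesis
      using Qx[of "g z"] Vx[of "g z"]
      by (simp add: F_def Q_def V_def conj_B sum_distrib_left mult_ac)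
  qed
  \<comment> \<open>Each summand is the one-coordinate identity; the weights d i and d i (m i)^2 add
    up to \<open>D1\<close> and \<open>D2\<close>.\<close>
  have "has_bochner_integral (normal_id UNIV m) (\<lambda>z. F (B *v g z)) (\<Sum>i\<in>I. d i * (c2 + (m i)\<^sup>2 * c4))"
    unfolding F_g c2_def c4_def
    using assms \<Delta> card_I \<open>rank Q = k\<close>
    by (intro has_bochner_integral_sum has_bochner_integral_mult_right has_bochner_integral_normal_id_square) auto
  then have "(\<integral>z. F (B *v g z) \<partial>normal_id UNIV m) = c2 * D1 + c4 * D2"
    by (simp add: has_bochner_integral_iff D1 D2 sum_distrib_left sum.distrib algebra_simps)
  moreover have "(\<integral>\<omega>. F (X \<omega>) \<partial>M) = (\<integral>x. F x \<partial>distr M borel X)"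
    using \<open>X \<in> borel_measurable M\<close> by (subst integral_distr) auto
  moreover have "\<dots> = (\<integral>z. F (B *v g z) \<partial>normal_id UNIV m)"
    unfolding law by (subst integral_distr) auto
  ultimately show ?thesis
    by (simp add: F_def c2_def c4_def)
qed

end
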